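(* For every natural number $k \geq 2$ there exist a natural number $\ell$ and a constant $c_k > 0$ (depending only on $k$) such that $\mathrm{ex}(n, \theta_{k,\ell}) \geq c_k\, n^{1+1/k}$ for all sufficiently large $n$. That is, $\mathrm{ex}(n, \theta_{k, \ell}) = \Omega_k(n^{1 + 1/k})$.
   Context: For a graph $H$, $\mathrm{ex}(n,H)$ denotes the maximum number of edges in a graph on $n$ vertices that contains no (not necessarily induced) subgraph isomorphic to $H$. For natural numbers $k$ and $\ell$, $\theta_{k,\ell}$ denotes the graph consisting of $\ell$ internally vertex-disjoint paths, each of length $k$ (i.e. with $k$ edges), all having the same two endpoints. The notation $\Omega_k$ means the implied constant depends only on $k$. *)

theory Defs
  imports Complex_Main "Graph_Theory.Graph_Theory"
begin

(* Following Graph_Theory, a finite simple graph is a finite loop-free symmetric digraph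
   without parallel arcs (locale pair_graph), so every edge {u,v} is represented by the two
   arcs (u,v) and (v,u).  The function below recovers the undirected edges. *)

definition uedges :: "'a pair_pre_digraph \<Rightarrow> 'a set set" where
  "uedges G = (\<lambda>(u, v). {u, v}) ` parcs G"

definition contains_copy :: "'a pair_pre_digraph \<Rightarrow> 'b pair_pre_digraph \<Rightarrow> bool" where
  "contains_copy G H \<longleftrightarrow>
     (\<exists>S. subgraph (with_proj S) (with_proj G) \<and> digraph_iso (with_proj H) (with_proj S))"

(* Every finite graph is isomorphic to one with vertices in nat, so it is enough to consider
   host graphs over nat. *)

definition free_graphs :: "nat \<Rightarrow> 'b pair_pre_digraph \<Rightarrow> nat pair_pre_digraph set" where
  "free_graphs n H = {G. pair_graph G \<and> card (pverts G) = n \<and> \<not> contains_copy G H}"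

(* The maximum is over a finite set, which is non-empty if H has an edge (see
   extremal_number_attained below); otherwise the value may be unspecified. *)

definition extremal_number :: "nat \<Rightarrow> 'b pair_pre_digraph \<Rightarrow> nat" where
  "extremal_number n H = Max ((\<lambda>G. card (uedges G)) ` free_graphs n H)"

datatype theta_vertex = Source | Target | Inner nat nat

(* The j-th vertex, 0 \<le> j \<le> k, on the i-th path of theta k l. *)

definition theta_path :: "nat \<Rightarrow> nat \<Rightarrow> nat \<Rightarrow> theta_vertex" where
  "theta_path k i j = (if j = 0 then Source else if j = k then Target else Inner i j)"

(* For k = 1 the l paths collapse to a single edge; for k = 0 the definition is meaningless. *)

definition theta :: "nat \<Rightarrow> nat \<Rightarrow> theta_vertex pair_pre_digraph" where
  "theta k l =
     (let A = {(theta_path k i j, theta_path k i (Suc j)) | i j. i < l \<and> j < k}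
      in \<lparr> pverts = {Source, Target} \<union> {theta_path k i j | i j. i < l \<and> j \<le> k},
           parcs = A \<union> A\<inverse> \<rparr>)"

lemma pair_graph_theta: "pair_graph (theta k l)"
proof -
  let ?A = "{(theta_path k i j, theta_path k i (Suc j)) | i j. i < l \<and> j < k}"
  let ?V = "{theta_path k i j | i j. i < l \<and> j \<le> k}"
  have A: "?A = (\<lambda>(i, j). (theta_path k i j, theta_path k i (Suc j))) ` ({..<l} \<times> {..<k})"
    by auto
  have V: "?V = (\<lambda>(i, j). theta_path k i j) ` ({..<l} \<times> {..k})"
    by auto
  have fin: "finite ?A" "finite ?V"
    unfolding A V by simp_all
  have sub: "?A \<subseteq> ?V \<times> ?V"
  proof
    fix e assume "e \<in> ?A"
    then obtain i j where e: "e = (theta_path k i j, theta_path k i (Suc j))" "i < l" "j < k"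
      by blast
    then have "theta_path k i j \<in> ?V" "theta_path k i (Suc j) \<in> ?V"
      using less_imp_le[of j k] Suc_leI[of j k] by blast+
    then show "e \<in> ?V \<times> ?V"
      using e(1) by blast
  qed
  have loop: "\<And>x y. (x, y) \<in> ?A \<Longrightarrow> x \<noteq> y"
    by (auto simp: theta_path_def split: if_splits)
  have eq: "pverts (theta k l) = {Source, Target} \<union> ?V" "parcs (theta k l) = ?A \<union> ?A\<inverse>"
    by (simp_all add: theta_def Let_def)
  show ?thesis
  proof
    fix e assume "e \<in> parcs (theta k l)"
    then consider "(fst e, snd e) \<in> ?A" | "(snd e, fst e) \<in> ?A"
      unfolding eq by (cases e) auto
    then have "fst e \<in> ?V \<and> snd e \<in> ?V \<and> fst e \<noteq> snd e"
    proof cases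
      case 1
      then show ?thesis
        using subsetD[OF sub 1] loop[OF 1] by (simp only: mem_Sigma_iff simp_thms)
    next
      case 2
      then show ?thesis
        using subsetD[OF sub 2] loop[OF 2] by (simp only: mem_Sigma_iff simp_thms) simp
    qed
    then show "fst e \<in> pverts (theta k l)" "snd e \<in> pverts (theta k l)" "fst e \<noteq> snd e"
      unfolding eq by (simp_all only: Un_iff simp_thms)
  next
    show "finite (pverts (theta k l))" "finite (parcs (theta k l))"
      unfolding eq using fin by simp_all
    show "symmetric (with_proj (theta k l))"
      unfolding symmetric_def with_proj_simps eq by (auto simp: sym_def)
  qed
qed

lemma contains_copy_iff:
  assumes G: "pair_graph G" and H: "pair_graph H"
  shows "contains_copy G H \<longleftrightarrow>
    (\<exists>f. inj_on f (pverts H) \<and> f ` pverts H \<subseteq> pverts G \<and>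
         (\<forall>(u, v) \<in> parcs H. (f u, f v) \<in> parcs G))"
proof
  assume "contains_copy G H"
  then obtain S h where S: "subgraph (with_proj S) (with_proj G)"
    and h: "pre_digraph.digraph_isomorphism (with_proj H) h"
    and eq: "with_proj S = app_iso h (with_proj H)"
    unfolding contains_copy_def digraph_iso_def by blast
  have vS: "pverts S = iso_verts h ` pverts H" and aS: "parcs S = iso_arcs h ` parcs H"
    and t: "iso_tail h = fst" and hd: "iso_head h = snd"
    using arg_cong[OF eq, of verts] arg_cong[OF eq, of arcs]
      arg_cong[OF eq, of tail] arg_cong[OF eq, of head]
    by (simp_all add: app_iso_def)
  have inj: "inj_on (iso_verts h) (pverts H)"
    and c: "\<And>a. a \<in> parcs H \<Longrightarrow> iso_verts h (fst a) = fst (iso_arcs h a) \<and>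
                       iso_verts h (snd a) = snd (iso_arcs h a)"
    using h t hd by (simp_all add: pre_digraph.digraph_isomorphism_def)
  have SG: "pverts S \<subseteq> pverts G" "parcs S \<subseteq> parcs G"
    using S by (simp_all add: subgraph_def)
  have "(iso_verts h u, iso_verts h v) \<in> parcs G" if "(u, v) \<in> parcs H" for u v
  proof -
    have "(iso_verts h u, iso_verts h v) = iso_arcs h (u, v)"
      using c[OF that] by (simp add: prod_eq_iff)
    then show ?thesis using that aS SG by auto
  qed
  then show "\<exists>f. inj_on f (pverts H) \<and> f ` pverts H \<subseteq> pverts G \<and>
         (\<forall>(u, v) \<in> parcs H. (f u, f v) \<in> parcs G)"
    using inj SG vS by blast
next
  assume "\<exists>f. inj_on f (pverts H) \<and> f ` pverts H \<subseteq> pverts G \<and>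
         (\<forall>(u, v) \<in> parcs H. (f u, f v) \<in> parcs G)"
  then obtain f where f: "inj_on f (pverts H)" "f ` pverts H \<subseteq> pverts G"
    "\<forall>(u, v) \<in> parcs H. (f u, f v) \<in> parcs G"
    by blast
  interpret G: pair_graph G by (rule G)
  interpret H: pair_graph H by (rule H)
  define S where "S = \<lparr> pverts = f ` pverts H, parcs = map_prod f f ` parcs H \<rparr>"
  define h where "h = \<lparr> iso_verts = f, iso_arcs = map_prod f f, iso_head = snd, iso_tail = fst \<rparr>"
  have "parcs H \<subseteq> pverts H \<times> pverts H"
    using H.in_arcsD1 H.in_arcsD2 by auto
  then have "inj_on (map_prod f f) (parcs H)"
    using map_prod_inj_on[OF f(1) f(1)] inj_on_subset by blast
  then have iso: "pre_digraph.digraph_isomorphism (with_proj H) h"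
    using f(1) H.wf_digraph by (simp add: pre_digraph.digraph_isomorphism_def h_def)
  have "with_proj S = app_iso h (with_proj H)"
    by (simp add: with_proj_def app_iso_def S_def h_def)
  moreover have "wf_digraph (with_proj S)"
    by unfold_locales (auto simp: S_def dest: H.in_arcsD1 H.in_arcsD2)
  then have "subgraph (with_proj S) (with_proj G)"
    using f G.wf_digraph by (auto simp: subgraph_def compatible_def S_def)
  ultimately show "contains_copy G H"
    using iso unfolding contains_copy_def digraph_iso_def by blast
qed

lemma extremal_number_attained:
  assumes H: "pair_graph H" and ne: "parcs H \<noteq> {}"
  shows "finite ((\<lambda>G. card (uedges G)) ` free_graphs n H)"
    and "\<exists>G \<in> free_graphs n H. card (uedges G) = extremal_number n H"
proof -
  have "card (uedges G) \<le> n * n" if "G \<in> free_graphs n H" for G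
  proof -
    interpret G: pair_graph G using that by (simp add: free_graphs_def)
    have "parcs G \<subseteq> pverts G \<times> pverts G"
      using G.in_arcsD1 G.in_arcsD2 by auto
    then have "card (parcs G) \<le> card (pverts G \<times> pverts G)"
      using G.pair_finite_verts by (intro card_mono) auto
    also have "\<dots> = n * n"
      using that by (simp add: free_graphs_def card_cartesian_product)
    finally show ?thesis
      using card_image_le[OF G.pair_finite_arcs] unfolding uedges_def by (rule le_trans[rotated])
  qed
  then show fin: "finite ((\<lambda>G. card (uedges G)) ` free_graphs n H)"
    by (intro finite_subset[OF _ finite_atMost[of "n * n"]]) auto
  let ?E = "\<lparr> pverts = {..<n}, parcs = {} \<rparr> :: nat pair_pre_digraph"
  have E: "pair_graph ?E"
    by unfold_locales (auto simp: symmetric_def sym_def)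
  have "\<not> contains_copy ?E H"
    using ne by (auto simp: contains_copy_iff[OF E H])
  then have "?E \<in> free_graphs n H"
    using E by (simp add: free_graphs_def)
  then have "extremal_number n H \<in> (\<lambda>G. card (uedges G)) ` free_graphs n H"
    unfolding extremal_number_def by (intro Max_in fin) blast
  then show "\<exists>G \<in> free_graphs n H. card (uedges G) = extremal_number n H"
    by force
qed

end

theory Submission
  imports Defs "HOL-Algebra.Algebraic_Closure_Type" "HOL-Library.Z2"
begin

text \<open>
  Let \<open>q = 2\<^sup>r\<close>. Both sides of a bipartite graph are copies of \<open>F\<^sub>q\<^sup>k\<close>, and \<open>x\<close> is joined to the
  \<open>q\<close> vertices \<open>(b, g\<^sub>1(x, b), \<dots>, g\<^sub>k\<^sub>-\<^sub>1(x, b))\<close>, where the \<open>g\<^sub>j\<close> are polynomials of bounded degree whose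
  coefficients are generic: they satisfy no nonzero polynomial relation over \<open>F\<^sub>2\<close> with exponents
  below a constant \<open>M\<close>. This has \<open>q\<^sup>k\<^sup>+\<^sup>1\<close> edges.

  Over the finite field \<open>F\<^sub>2\<close> there are only boundedly many polynomials with exponents below \<open>M\<close>, so
  only boundedly many elements are algebraic, with bounded degrees, over a bounded set of elements.
  Hence, if a copy of \<open>\<theta>\<^sub>k\<^sub>,\<^sub>l\<close> is present with \<open>l\<close> large, one can choose \<open>s = 2k + 1\<close> of its paths such
  that coordinates \<open>t\<^sub>1, \<dots>, t\<^sub>s\<close> of their first inner vertices are independent over the coefficients.
  On the other hand, the \<open>sk\<close> edges of these paths impose \<open>(k - 1)sk\<close> independent linear conditions on
  the coefficients, so coefficients and \<open>t\<^sub>i\<close> together are rational functions of the coordinates of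
  the \<open>2 + s(k - 1)\<close> vertices and of all but \<open>(k - 1)sk\<close> of the coefficients. Their transcendence degree is
  thus too small by \<open>s - 2k = 1\<close>. Since \<open>M\<close> is fixed before \<open>l\<close> and \<open>q\<close>, a pigeonhole argument makes this
  quantitative, and no point counts of varieties over \<open>F\<^sub>q\<close> are needed.
\<close>

section \<open>Polynomial values and independence over a finite ring of coefficients\<close>

text \<open>Finiteness of the coefficients is what allows polynomials with bounded exponents to be
  counted; the arguments replacing transcendence degree are all counts of this kind.\<close>

locale finite_coeff_ring =
  fixes K :: "'a::field set"
  assumes finite_K: "finite K"
    and zero_K: "0 \<in> K" and one_K: "1 \<in> K"
    and add_K: "\<And>x y. x \<in> K \<Longrightarrow> y \<in> K \<Longrightarrow> x + y \<in> K"
    and mult_K: "\<And>x y. x \<in> K \<Longrightarrow> y \<in> K \<Longrightarrow> x * y \<in> K"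
    and uminus_K: "\<And>x. x \<in> K \<Longrightarrow> - x \<in> K"
begin

text \<open>\<open>monoms\<close> and \<open>vals\<close> hold field elements, not formal
  polynomials: different exponent vectors may give the same element, so cardinalities are only
  bounded from above. The number \<open>d\<close> bounds the degree in each variable
  separately.\<close>

definition monoms :: "'a set \<Rightarrow> nat \<Rightarrow> 'a set" where
  "monoms Z d = (\<lambda>e. \<Prod>z\<in>Z. z ^ e z) ` (Z \<rightarrow>\<^sub>E {..d})"

definition vals :: "'a set \<Rightarrow> nat \<Rightarrow> 'a set" where
  "vals Z d = (\<lambda>c. \<Sum>m\<in>monoms Z d. c m * m) ` (monoms Z d \<rightarrow>\<^sub>E K)"

text \<open>Every element of a finite field is algebraic over the prime field, so only relations
  with exponents below \<open>M\<close> can be excluded.\<close>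

definition alg_indep :: "nat \<Rightarrow> 'a set \<Rightarrow> bool" where
  "alg_indep M Y \<longleftrightarrow> finite Y \<and>
     (\<forall>c. c \<in> (Y \<rightarrow>\<^sub>E {..<M}) \<rightarrow> K \<longrightarrow> (\<exists>e \<in> Y \<rightarrow>\<^sub>E {..<M}. c e \<noteq> 0) \<longrightarrow>
        (\<Sum>e\<in>Y \<rightarrow>\<^sub>E {..<M}. c e * (\<Prod>y\<in>Y. y ^ e y)) \<noteq> 0)"

lemma card_K_ge: "card K \<ge> 2"
proof -
  have "card {0, 1 :: 'a} \<le> card K"
    using zero_K one_K finite_K by (intro card_mono) auto
  then show ?thesis by simp
qed

lemma monoms_I: "(\<And>z. z \<in> Z \<Longrightarrow> e z \<le> d) \<Longrightarrow> (\<Prod>z\<in>Z. z ^ e z) \<in> monoms Z d"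
  unfolding monoms_def
  by (rule image_eqI[of _ _ "restrict e Z"]) (auto intro!: prod.cong)

lemma monoms_E:
  assumes "m \<in> monoms Z d"
  obtains e where "\<And>z. z \<in> Z \<Longrightarrow> e z \<le> d" "m = (\<Prod>z\<in>Z. z ^ e z)"
  using assms unfolding monoms_def by auto

lemma finite_monoms: "finite Z \<Longrightarrow> finite (monoms Z d)"
  unfolding monoms_def by (auto intro!: finite_PiE)

lemma card_monoms: "finite Z \<Longrightarrow> card (monoms Z d) \<le> Suc d ^ card Z"
  unfolding monoms_def
  by (rule order.trans[OF card_image_le]) (auto intro!: finite_PiE simp: card_PiE)

lemma monoms_mult:
  assumes "x \<in> monoms Z d" "y \<in> monoms Z d'"
  shows "x * y \<in> monoms Z (d + d')"
proof -
  obtain e where e: "\<And>z. z \<in> Z \<Longrightarrow> e z \<le> d" "x = (\<Prod>z\<in>Z. z ^ e z)"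
    using monoms_E[OF assms(1)] by blast
  obtain e' where e': "\<And>z. z \<in> Z \<Longrightarrow> e' z \<le> d'" "y = (\<Prod>z\<in>Z. z ^ e' z)"
    using monoms_E[OF assms(2)] by blast
  have "x * y = (\<Prod>z\<in>Z. z ^ (e z + e' z))"
    by (simp add: e e' power_add prod.distrib)
  also have "\<dots> \<in> monoms Z (d + d')"
    by (rule monoms_I) (simp add: e e' add_mono)
  finally show ?thesis .
qed

lemma monoms_mono: "d \<le> d' \<Longrightarrow> monoms Z d \<subseteq> monoms Z d'"
  by (auto elim!: monoms_E intro!: monoms_I intro: order.trans)

lemma vals_I: "(\<And>m. m \<in> monoms Z d \<Longrightarrow> c m \<in> K) \<Longrightarrow> (\<Sum>m\<in>monoms Z d. c m * m) \<in> vals Z d"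
  unfolding vals_def
  by (rule image_eqI[of _ _ "restrict c (monoms Z d)"]) (auto intro!: sum.cong)

lemma vals_E:
  assumes "x \<in> vals Z d"
  obtains c where "\<And>m. m \<in> monoms Z d \<Longrightarrow> c m \<in> K" "x = (\<Sum>m\<in>monoms Z d. c m * m)"
  using assms unfolding vals_def by auto

lemma finite_vals: "finite Z \<Longrightarrow> finite (vals Z d)"
  unfolding vals_def by (auto intro!: finite_PiE finite_monoms finite_K)

lemma card_vals:
  assumes "finite Z"
  shows "card (vals Z d) \<le> card K ^ (Suc d ^ card Z)"
proof -
  have "card (vals Z d) \<le> card (monoms Z d \<rightarrow>\<^sub>E K)"
    unfolding vals_def using assms
    by (intro card_image_le finite_PiE finite_monoms) (auto simp: finite_K)
  also have "\<dots> = card K ^ card (monoms Z d)"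
    using finite_monoms[OF assms] by (simp add: card_PiE)
  also have "\<dots> \<le> card K ^ (Suc d ^ card Z)"
    using card_K_ge card_monoms[OF assms] by (intro power_increasing) auto
  finally show ?thesis .
qed

lemma vals_zero: "0 \<in> vals Z d"
  using vals_I[of Z d "\<lambda>_. 0"] zero_K by simp

lemma vals_add:
  assumes "x \<in> vals Z d" "y \<in> vals Z d"
  shows "x + y \<in> vals Z d"
proof -
  obtain c where c: "\<And>m. m \<in> monoms Z d \<Longrightarrow> c m \<in> K" "x = (\<Sum>m\<in>monoms Z d. c m * m)"
    using vals_E[OF assms(1)] by blast
  obtain c' where c': "\<And>m. m \<in> monoms Z d \<Longrightarrow> c' m \<in> K" "y = (\<Sum>m\<in>monoms Z d. c' m * m)"
    using vals_E[OF assms(2)] by blast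
  have "x + y = (\<Sum>m\<in>monoms Z d. (c m + c' m) * m)"
    by (simp add: c c' sum.distrib distrib_right)
  also have "\<dots> \<in> vals Z d"
    by (rule vals_I) (simp add: c c' add_K)
  finally show ?thesis .
qed

lemma vals_sum: "(\<And>i. i \<in> I \<Longrightarrow> f i \<in> vals Z d) \<Longrightarrow> (\<Sum>i\<in>I. f i) \<in> vals Z d"
  by (induction I rule: infinite_finite_induct) (auto simp: vals_zero vals_add)

lemma vals_monom:
  assumes "finite Z" "m \<in> monoms Z d" "a \<in> K"
  shows "a * m \<in> vals Z d"
proof -
  have "(\<Sum>m'\<in>monoms Z d. (if m' = m then a else 0) * m') \<in> vals Z d"
    by (rule vals_I) (simp add: assms zero_K)
  also have "(\<Sum>m'\<in>monoms Z d. (if m' = m then a else 0) * m') = a * m"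
    using assms finite_monoms[of Z d]
    by (subst sum.remove[of _ m]) (auto intro!: sum.neutral)
  finally show ?thesis .
qed

lemma vals_mult:
  assumes Z: "finite Z" and "x \<in> vals Z d" "y \<in> vals Z d'"
  shows "x * y \<in> vals Z (d + d')"
proof -
  obtain c where c: "\<And>m. m \<in> monoms Z d \<Longrightarrow> c m \<in> K" "x = (\<Sum>m\<in>monoms Z d. c m * m)"
    using vals_E[OF assms(2)] by blast
  obtain c' where c': "\<And>m. m \<in> monoms Z d' \<Longrightarrow> c' m \<in> K" "y = (\<Sum>m\<in>monoms Z d'. c' m * m)"
    using vals_E[OF assms(3)] by blast
  have "x * y = (\<Sum>m\<in>monoms Z d. \<Sum>m'\<in>monoms Z d'. (c m * c' m') * (m * m'))"
    unfolding c(2) c'(2) sum_product by (simp add: mult_ac)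
  also have "\<dots> \<in> vals Z (d + d')"
    by (intro vals_sum vals_monom Z monoms_mult mult_K c c')
  finally show ?thesis .
qed

lemma vals_uminus: "x \<in> vals Z d \<Longrightarrow> - x \<in> vals Z d"
  by (elim vals_E) (auto simp flip: sum_negf mult_minus_left intro!: vals_I uminus_K)

lemma vals_diff: "x \<in> vals Z d \<Longrightarrow> y \<in> vals Z d \<Longrightarrow> x - y \<in> vals Z d"
  using vals_add[of x Z d "- y"] vals_uminus by simp

lemma vals_mono:
  assumes "finite Z" "d \<le> d'" "x \<in> vals Z d"
  shows "x \<in> vals Z d'"
  using assms(3)
proof (rule vals_E)
  fix c assume "\<And>m. m \<in> monoms Z d \<Longrightarrow> c m \<in> K" "x = (\<Sum>m\<in>monoms Z d. c m * m)"
  then show ?thesis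
    using assms monoms_mono[OF assms(2)] by (auto intro!: vals_sum vals_monom)
qed

lemma vals_one: "finite Z \<Longrightarrow> 1 \<in> vals Z d"
  using vals_monom[of Z 1 d 1] monoms_I[of Z "\<lambda>_. 0" d] one_K by simp

lemma vals_gen:
  assumes "finite Z" "z \<in> Z"
  shows "z \<in> vals Z 1"
proof -
  have "(\<Prod>y\<in>Z. y ^ (if y = z then 1 else 0)) \<in> monoms Z 1"
    by (rule monoms_I) auto
  also have "(\<Prod>y\<in>Z. y ^ (if y = z then 1 else 0)) = z"
    using assms by (subst prod.remove[of _ z]) (auto intro!: prod.neutral)
  finally show ?thesis
    using vals_monom[of Z z 1 1] assms one_K by simp
qed

lemma vals_prod:
  assumes "finite Z" "\<And>i. i \<in> I \<Longrightarrow> f i \<in> vals Z d"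
  shows "(\<Prod>i\<in>I. f i) \<in> vals Z (card I * d)"
  using assms(2)
proof (induction I rule: infinite_finite_induct)
  case (insert i I)
  then show ?case using vals_mult[OF assms(1), of "f i" d "\<Prod>i\<in>I. f i" "card I * d"] by simp
qed (auto simp: vals_one assms(1))

lemma vals_power: "finite Z \<Longrightarrow> x \<in> vals Z d \<Longrightarrow> x ^ n \<in> vals Z (n * d)"
  using vals_prod[of Z "{..<n}" "\<lambda>_. x" d] by simp

text \<open>The pigeonhole principle stands in for the comparison of transcendence degrees: if the
  elements of \<open>Y\<close> are fractions of small degree in fewer elements \<open>Z\<close>, there are more polynomials
  with exponents below \<open>M\<close> in \<open>Y\<close> than possible values.\<close>

lemma not_alg_indep:
  assumes Z: "finite Z" "card Z < card Y"
    and B: "B \<in> vals Z D" "B \<noteq> 0" "\<And>y. y \<in> Y \<Longrightarrow> B * y \<in> vals Z D"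
    and M: "M > (card Y * D + 1) ^ card Y"
  shows "\<not> alg_indep M Y"
proof
  assume ind: "alg_indep M Y"
  then have Y: "finite Y" by (simp add: alg_indep_def)
  define Ex where "Ex = (Y \<rightarrow>\<^sub>E {..<M})"
  define ev where "ev c = (\<Sum>e\<in>Ex. c e * (\<Prod>y\<in>Y. y ^ e y))" for c
  let ?a = "card Y" and ?b = "card Z"
  have finEx: "finite Ex" and cardEx: "card Ex = M ^ ?a"
    using Y by (simp_all add: Ex_def finite_PiE card_PiE)
  have M0: "M > 0" using M by simp
  \<comment> \<open>Each of the \<open>card Y\<close> factors \<open>y ^ e y\<close> receives its
    own \<open>B ^ M\<close>, of which \<open>e y\<close> copies clear denominators. The resulting
    degree bound is the same for all \<open>e\<close>.\<close>
  have mon: "B ^ (?a * M) * (\<Prod>y\<in>Y. y ^ e y) \<in> vals Z (?a * (M * D))" if e: "e \<in> Ex" for e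
  proof -
    have le: "e y \<le> M" if "y \<in> Y" for y
      using PiE_mem[OF e[unfolded Ex_def] that] by simp
    have "B ^ (?a * M) * (\<Prod>y\<in>Y. y ^ e y) = (\<Prod>y\<in>Y. B ^ M * y ^ e y)"
      by (simp add: prod.distrib mult.commute flip: power_mult)
    also have "\<dots> = (\<Prod>y\<in>Y. B ^ (M - e y) * (B * y) ^ e y)"
      using le by (intro prod.cong) (auto simp: power_mult_distrib simp flip: power_add mult.assoc)
    also have "\<dots> \<in> vals Z (?a * (M * D))"
    proof (rule vals_prod[OF Z(1)])
      fix y assume y: "y \<in> Y"
      have "B ^ (M - e y) * (B * y) ^ e y \<in> vals Z ((M - e y) * D + e y * D)"
        using B y Z(1) by (intro vals_mult vals_power)
      also have "(M - e y) * D + e y * D = M * D"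
        using le[OF y] by (simp flip: add_mult_distrib)
      finally show "B ^ (M - e y) * (B * y) ^ e y \<in> vals Z (M * D)" .
    qed
    finally show ?thesis .
  qed
  have sub: "(\<lambda>c. B ^ (?a * M) * ev c) ` (Ex \<rightarrow>\<^sub>E K) \<subseteq> vals Z (?a * (M * D))"
  proof (rule image_subsetI)
    fix c assume c: "c \<in> Ex \<rightarrow>\<^sub>E K"
    have "B ^ (?a * M) * ev c = (\<Sum>e\<in>Ex. c e * (B ^ (?a * M) * (\<Prod>y\<in>Y. y ^ e y)))"
      by (simp add: ev_def sum_distrib_left mult_ac)
    also have "\<dots> \<in> vals Z (?a * (M * D))"
    proof (rule vals_sum)
      fix e assume e: "e \<in> Ex"
      have "c e \<in> vals Z 0"
        using vals_monom[of Z 1 0 "c e"] monoms_I[of Z "\<lambda>_. 0" 0] Z c e by auto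
      then show "c e * (B ^ (?a * M) * (\<Prod>y\<in>Y. y ^ e y)) \<in> vals Z (?a * (M * D))"
        using vals_mult[OF Z(1) _ mon[OF e], of "c e" 0] by simp
    qed
    finally show "B ^ (?a * M) * ev c \<in> vals Z (?a * (M * D))" .
  qed
  \<comment> \<open>The bound on the number of monomials in \<open>Z\<close> is a constant times
    \<open>M ^ card Z\<close>. The hypothesis on \<open>M\<close> absorbs the constant into one more
    factor \<open>M\<close>, and there are \<open>M ^ card Y\<close> exponent vectors for
    \<open>Y\<close>.\<close>
  have "Suc (?a * (M * D)) ^ ?b \<le> ((?a * D + 1) * M) ^ ?b"
    using M0 by (intro power_mono) (auto simp: algebra_simps)
  also have "\<dots> = (?a * D + 1) ^ ?b * M ^ ?b"
    by (rule power_mult_distrib)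
  also have "\<dots> \<le> (?a * D + 1) ^ ?a * M ^ ?b"
    using Z(2) by (intro mult_right_mono power_increasing) auto
  also have "\<dots> < M * M ^ ?b"
    using M M0 by simp
  also have "\<dots> \<le> M ^ ?a"
    using Z(2) M0 power_increasing[of "Suc ?b" ?a M] by simp
  finally have lt: "Suc (?a * (M * D)) ^ ?b < M ^ ?a" .
  have "card (vals Z (?a * (M * D))) \<le> card K ^ (Suc (?a * (M * D)) ^ ?b)"
    by (rule card_vals[OF Z(1)])
  also have "\<dots> < card K ^ (M ^ ?a)"
    using card_K_ge lt by (intro power_strict_increasing) auto
  also have "\<dots> = card (Ex \<rightarrow>\<^sub>E K)"
    using finEx by (simp add: card_PiE cardEx)
  finally have "card ((\<lambda>c. B ^ (?a * M) * ev c) ` (Ex \<rightarrow>\<^sub>E K)) < card (Ex \<rightarrow>\<^sub>E K)"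
    using card_mono[OF finite_vals[OF Z(1)] sub] by simp
  \<comment> \<open>Two coefficient families with the same value differ by a nonzero
    relation.\<close>
  then have "\<not> inj_on (\<lambda>c. B ^ (?a * M) * ev c) (Ex \<rightarrow>\<^sub>E K)"
    by (rule pigeonhole)
  then obtain c c' where cc: "c \<in> Ex \<rightarrow>\<^sub>E K" "c' \<in> Ex \<rightarrow>\<^sub>E K" "c \<noteq> c'"
    "B ^ (?a * M) * ev c = B ^ (?a * M) * ev c'"
    unfolding inj_on_def by blast
  have "ev c = ev c'" using cc(4) B(2) by simp
  then have "ev (\<lambda>e. c e - c' e) = 0"
    by (simp add: ev_def left_diff_distrib sum_subtractf)
  moreover have "(\<lambda>e. c e - c' e) \<in> Ex \<rightarrow> K"
    using cc add_K[of "c e" "- c' e" for e] uminus_K by (force simp: Pi_iff PiE_iff)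
  moreover have "\<exists>e\<in>Ex. c e - c' e \<noteq> 0"
    using cc by (auto dest: PiE_ext)
  ultimately show False
    using ind unfolding alg_indep_def ev_def Ex_def by blast
qed

section \<open>Elements of bounded algebraic degree and the greedy choice of independent
  ones\<close>

definition algebraic_over :: "nat \<Rightarrow> 'a set \<Rightarrow> 'a set" where
  "algebraic_over M Y =
     (\<Union>a\<in>{a \<in> {..<M} \<rightarrow>\<^sub>E vals Y M. \<exists>j<M. a j \<noteq> 0}. {x. (\<Sum>j<M. a j * x ^ j) = 0})"

text \<open>The number of coefficient sequences times at most \<open>M\<close> roots each, plus
  \<open>n\<close> for the elements of the base set. It depends only on \<open>card K\<close>,
  \<open>M\<close> and \<open>n\<close>, not on the field in which the elements lie.\<close>

definition algebraic_bound :: "nat \<Rightarrow> nat \<Rightarrow> nat" where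
  "algebraic_bound M n = (card K ^ (Suc M ^ n)) ^ M * M + n"

lemma card_algebraic_over:
  assumes Y: "finite Y"
  shows "finite (algebraic_over M Y \<union> Y)" "card (algebraic_over M Y \<union> Y) \<le> algebraic_bound M (card Y)"
proof -
  let ?A = "{a \<in> {..<M} \<rightarrow>\<^sub>E vals Y M. \<exists>j<M. a j \<noteq> 0}"
  have roots: "finite {x. (\<Sum>j<M. a j * x ^ j) = 0} \<and> card {x. (\<Sum>j<M. a j * x ^ j) = 0} \<le> M"
    if a: "\<exists>j<M. a j \<noteq> 0" for a :: "nat \<Rightarrow> 'a"
  proof -
    define p where "p = (\<Sum>j<M. monom (a j) j)"
    have cf: "coeff p j = (if j < M then a j else 0)" for j
      by (simp add: p_def coeff_sum)
    have p: "p \<noteq> 0" using a cf by (metis coeff_0)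
    have "degree p \<le> M"
      by (rule degree_le) (simp add: cf)
    moreover have "poly p x = (\<Sum>j<M. a j * x ^ j)" for x
      by (simp add: p_def poly_sum poly_monom)
    ultimately show ?thesis
      using poly_roots_finite[OF p] card_poly_roots_bound[OF p] by simp
  qed
  have finA: "finite ({..<M} \<rightarrow>\<^sub>E vals Y M)"
    using finite_vals[OF Y] by (intro finite_PiE) auto
  then have finA': "finite ?A" by simp
  have fin: "finite (algebraic_over M Y)"
    unfolding algebraic_over_def using roots finA' by (intro finite_UN_I) auto
  then show "finite (algebraic_over M Y \<union> Y)" using Y by simp
  have "card ?A \<le> card ({..<M} \<rightarrow>\<^sub>E vals Y M)"
    using finA by (intro card_mono) auto
  also have "\<dots> = card (vals Y M) ^ M"
    by (simp add: card_PiE)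
  also have "\<dots> \<le> (card K ^ (Suc M ^ card Y)) ^ M"
    by (intro power_mono card_vals Y) simp
  finally have cA: "card ?A \<le> (card K ^ (Suc M ^ card Y)) ^ M" .
  have "card (algebraic_over M Y) \<le> (\<Sum>a\<in>?A. card {x. (\<Sum>j<M. a j * x ^ j) = 0})"
    unfolding algebraic_over_def by (rule card_UN_le[OF finA'])
  also have "\<dots> \<le> (\<Sum>a\<in>?A. M)"
    using roots by (intro sum_mono) auto
  also have "\<dots> = card ?A * M" by simp
  also have "\<dots> \<le> (card K ^ (Suc M ^ card Y)) ^ M * M"
    using cA by (rule mult_right_mono) simp
  finally show "card (algebraic_over M Y \<union> Y) \<le> algebraic_bound M (card Y)"
    unfolding algebraic_bound_def using card_Un_le[of "algebraic_over M Y" Y] by linarith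
qed

lemma algebraic_bound_mono: "m \<le> n \<Longrightarrow> algebraic_bound M m \<le> algebraic_bound M n"
  unfolding algebraic_bound_def using card_K_ge
  by (intro add_mono mult_right_mono power_mono power_increasing) auto

lemma alg_indep_empty: "alg_indep M {}"
  by (auto simp: alg_indep_def)

text \<open>Sort a relation by powers of \<open>x\<close>. The coefficients lie in
  \<open>vals Y M\<close>, and independence of \<open>Y\<close> makes one of them nonzero as a field
  element, so \<open>x\<close> would be algebraic over \<open>Y\<close>.\<close>

lemma alg_indep_insert:
  assumes ind: "alg_indep M Y" and x: "x \<notin> algebraic_over M Y \<union> Y"
  shows "alg_indep M (insert x Y)"
  unfolding alg_indep_def
proof (intro conjI allI impI notI)
  have Y: "finite Y" using ind by (simp add: alg_indep_def)
  then show "finite (insert x Y)" by simp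
  let ?Ex = "Y \<rightarrow>\<^sub>E {..<M}" and ?Ex' = "insert x Y \<rightarrow>\<^sub>E {..<M}"
  fix c assume c: "c \<in> ?Ex' \<rightarrow> K" "\<exists>e\<in>?Ex'. c e \<noteq> 0"
    and z: "(\<Sum>e\<in>?Ex'. c e * (\<Prod>y\<in>insert x Y. y ^ e y)) = 0"
  define a where "a j = (\<Sum>e\<in>?Ex. c (e(x := j)) * (\<Prod>y\<in>Y. y ^ e y))" for j
  have xY: "x \<notin> Y" using x by simp
  have aV: "a j \<in> vals Y M" if "j < M" for j
    unfolding a_def
  proof (intro vals_sum vals_monom Y)
    fix e assume e: "e \<in> ?Ex"
    show "(\<Prod>y\<in>Y. y ^ e y) \<in> monoms Y M"
      using e by (intro monoms_I less_imp_le) (auto simp: PiE_iff)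
    show "c (e(x := j)) \<in> K"
      using c(1) that e by (auto simp: PiE_insert_eq)
  qed
  have inj: "inj_on (\<lambda>(j, e). e(x := j)) ({..<M} \<times> ?Ex)"
    using inj_combinator[OF xY, of "\<lambda>_. {..<M}"] by simp
  have mon: "(\<Prod>y\<in>insert x Y. y ^ (e(x := j)) y) = x ^ j * (\<Prod>y\<in>Y. y ^ e y)" for j e
  proof -
    have "(\<Prod>y\<in>Y. y ^ (e(x := j)) y) = (\<Prod>y\<in>Y. y ^ e y)"
      using xY by (intro prod.cong) auto
    then show ?thesis using Y xY by simp
  qed
  have "0 = (\<Sum>(j, e)\<in>{..<M} \<times> ?Ex. c (e(x := j)) * (\<Prod>y\<in>insert x Y. y ^ (e(x := j)) y))"
    unfolding z[symmetric] PiE_insert_eq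
    by (subst sum.reindex[OF inj]) (simp add: case_prod_unfold)
  also have "\<dots> = (\<Sum>j<M. \<Sum>e\<in>?Ex. c (e(x := j)) * (x ^ j * (\<Prod>y\<in>Y. y ^ e y)))"
    unfolding sum.cartesian_product[symmetric] mon ..
  also have "\<dots> = (\<Sum>j<M. a j * x ^ j)"
    by (simp add: a_def sum_distrib_left sum_distrib_right mult_ac)
  finally have root: "(\<Sum>j<M. restrict a {..<M} j * x ^ j) = 0" by simp
  obtain e where e: "e \<in> ?Ex'" "c e \<noteq> 0" using c(2) by blast
  then obtain j e' where je: "j < M" "e' \<in> ?Ex" "e = e'(x := j)"
    unfolding PiE_insert_eq by auto
  have "(\<lambda>e. c (e(x := j))) \<in> ?Ex \<rightarrow> K"
    using c(1) je(1) by (auto simp: PiE_insert_eq)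
  then have "a j \<noteq> 0"
    using ind e je unfolding alg_indep_def a_def by blast
  then have "x \<in> algebraic_over M Y"
    unfolding algebraic_over_def using root je(1) aV by (intro UN_I[of "restrict a {..<M}"]) auto
  then show False using x by simp
qed

text \<open>Greedy choice: as long as fewer than \<open>n\<close> elements are chosen,
  \<open>F\<close> is too large to consist of chosen elements and elements algebraic over
  them.\<close>

lemma alg_indep_exists:
  assumes F: "finite F" and C: "card F > algebraic_bound M n"
  shows "\<exists>Y\<subseteq>F. card Y = n \<and> alg_indep M Y"
  using C
proof (induction n)
  case 0
  then show ?case using alg_indep_empty by force
next
  case (Suc n)
  then obtain Y where Y: "Y \<subseteq> F" "card Y = n" "alg_indep M Y"
    using algebraic_bound_mono[of n "Suc n" M] by auto
  have fY: "finite Y" using Y F finite_subset by blast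
  have "card (algebraic_over M Y \<union> Y) < card F"
    using card_algebraic_over(2)[OF fY, of M] Y(2) Suc.prems algebraic_bound_mono[of n "Suc n" M] by simp
  then obtain x where x: "x \<in> F" "x \<notin> algebraic_over M Y \<union> Y"
    using card_mono[OF card_algebraic_over(1)[OF fY, of M], of F] by (meson linorder_not_le subsetI)
  show ?case
    using alg_indep_insert[OF Y(3) x(2)] x Y fY by (intro exI[of _ "insert x Y"]) auto
qed

lemma alg_indep_extend_coords:
  fixes v :: "'i \<Rightarrow> 'b \<Rightarrow> 'a"
  assumes ind: "alg_indep M Y"
    and I: "finite I" "inj_on v I" "finite J" "\<And>i. i \<in> I \<Longrightarrow> v i \<in> extensional J"
    and card: "card I \<ge> s + algebraic_bound M (card Y + s) ^ card J"
  shows "\<exists>S\<subseteq>I. \<exists>T. card S = s \<and> finite T \<and> card T = s \<and> T \<inter> Y = {} \<and> alg_indep M (Y \<union> T) \<and>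
           T \<subseteq> (\<Union>i\<in>S. v i ` J)"
  using card
proof (induction s)
  case 0
  then show ?case using ind by (intro exI[of _ "{}"]) auto
next
  case (Suc s)
  have Y: "finite Y" using ind by (simp add: alg_indep_def)
  have "algebraic_bound M (card Y + s) ^ card J \<le> algebraic_bound M (card Y + Suc s) ^ card J"
    by (intro power_mono algebraic_bound_mono) auto
  then have le: "card I \<ge> Suc s + algebraic_bound M (card Y + s) ^ card J"
    using Suc.prems by linarith
  then obtain S T where ST: "S \<subseteq> I" "card S = s" "finite T" "card T = s" "T \<inter> Y = {}"
    "alg_indep M (Y \<union> T)" "T \<subseteq> (\<Union>i\<in>S. v i ` J)"
    using Suc.IH by auto
  define A where "A = algebraic_over M (Y \<union> T) \<union> (Y \<union> T)"
  have cYT: "card (Y \<union> T) = card Y + s"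
    using ST Y by (simp add: card_Un_disjoint Int_commute)
  have A: "finite A" "card A \<le> algebraic_bound M (card Y + s)"
    using card_algebraic_over[of "Y \<union> T" M] Y ST(3) by (simp_all only: A_def cYT finite_Un simp_thms)
  have "\<exists>i\<in>I - S. \<exists>j\<in>J. v i j \<notin> A"
  proof (rule ccontr)
    assume "\<not> ?thesis"
    then have "v ` (I - S) \<subseteq> J \<rightarrow>\<^sub>E A"
      using I(4) by (auto simp: PiE_def)
    then have "card (v ` (I - S)) \<le> card (J \<rightarrow>\<^sub>E A)"
      using A I by (intro card_mono finite_PiE) auto
    also have "\<dots> \<le> algebraic_bound M (card Y + s) ^ card J"
      using A I by (simp add: card_PiE power_mono)
    also have "card (v ` (I - S)) = card I - s"
      using I ST finite_subset[OF ST(1)] by (subst card_image) (auto intro: inj_on_subset simp: card_Diff_subset)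
    finally show False using le by linarith
  qed
  then obtain i j where ij: "i \<in> I" "i \<notin> S" "j \<in> J" "v i j \<notin> A" by blast
  have "alg_indep M (insert (v i j) (Y \<union> T))"
    using alg_indep_insert[OF ST(6)] ij(4) by (simp add: A_def)
  then show ?case
    using ST ij finite_subset[OF ST(1) I(1)]
    by (intro exI[of _ "insert i S"] exI[of _ "insert (v i j) T"] conjI) (auto simp: A_def)
qed

end

section \<open>Interpolation\<close>

context finite_coeff_ring
begin

text \<open>For finite \<open>P\<close> the coefficients are, up to sign, elementary symmetric
  polynomials in the \<open>w p\<close>.\<close>

lemma vals_coeff_prod_linear:
  assumes Z: "finite Z" and w: "\<And>p. p \<in> P \<Longrightarrow> w p \<in> vals Z d"
  shows "coeff (\<Prod>p\<in>P. [:- w p, 1:]) i \<in> vals Z (card P * d)"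
  using w
proof (induction P arbitrary: i rule: infinite_finite_induct)
  case (insert p P)
  let ?q = "\<Prod>p\<in>P. [:- w p, 1:]"
  have q: "coeff ?q j \<in> vals Z (d + card P * d)" for j
    using insert vals_mono[OF Z, of "card P * d" "d + card P * d"] by simp
  have "w p * coeff ?q i \<in> vals Z (d + card P * d)"
    using insert by (intro vals_mult Z) auto
  then have "coeff ([:- w p, 1:] * ?q) i \<in> vals Z (d + card P * d)"
    using q by (cases i) (auto intro!: vals_diff vals_uminus)
  then show ?case using insert by simp
qed (auto simp: vals_one[OF Z] vals_zero split: if_splits)

text \<open>Lagrange interpolation at \<open>E\<close> nodes expresses the \<open>c i\<close> by
  nodes and values; \<open>B\<close> is a common denominator, the product of all differences of
  ordered pairs of nodes.\<close>

lemma vals_interpolation: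
  assumes Z: "finite Z" and P: "finite P" "inj_on w P"
    and w: "\<And>p. p \<in> P \<Longrightarrow> w p \<in> vals Z d" and r: "\<And>p. p \<in> P \<Longrightarrow> r p \<in> vals Z d'"
    and E: "card P = E" and c: "\<And>p. p \<in> P \<Longrightarrow> (\<Sum>i<E. c i * w p ^ i) = r p"
    and B: "B = (\<Prod>p\<in>P. \<Prod>p'\<in>P - {p}. w p - w p')"
  shows "B \<noteq> 0" "B \<in> vals Z (E * (E * d))"
    "i < E \<Longrightarrow> B * c i \<in> vals Z (d' + E * (E * d) + E * d)"
proof -
  \<comment> \<open>\<open>L p / N p\<close> is the Lagrange basis polynomial of the node
    \<open>w p\<close>.\<close>
  define L where "L p = (\<Prod>p'\<in>P - {p}. [:- w p', 1:])" for p
  define N where "N p = (\<Prod>p'\<in>P - {p}. w p - w p')" for p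
  have N0: "N p \<noteq> 0" if "p \<in> P" for p
    using that P by (auto simp: N_def inj_on_def)
  then show "B \<noteq> 0" using P by (simp add: B N_def)
  have NV: "N p \<in> vals Z (E * d)" if "p \<in> P" for p
  proof (rule vals_mono[OF Z])
    show "N p \<in> vals Z (card (P - {p}) * d)"
      unfolding N_def using w that by (intro vals_prod Z vals_diff) auto
    show "card (P - {p}) * d \<le> E * d"
      using P E card_mono[of P "P - {p}"] by (intro mult_right_mono) auto
  qed
  have LV: "coeff (L p) j \<in> vals Z (E * d)" for p j
  proof (rule vals_mono[OF Z])
    show "coeff (L p) j \<in> vals Z (card (P - {p}) * d)"
      unfolding L_def using w by (intro vals_coeff_prod_linear Z) auto
    show "card (P - {p}) * d \<le> E * d"
      using P E card_mono[of P "P - {p}"] by (intro mult_right_mono) auto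
  qed
  show "B \<in> vals Z (E * (E * d))"
    using vals_prod[OF Z, of P N] NV by (simp add: B N_def[symmetric] E)
  assume i: "i < E"
  define C where "C = (\<Sum>i<E. monom (c i) i)"
  have "C = (\<Sum>p\<in>P. smult (r p / N p) (L p))"
  proof (rule poly_eqI_degree[of "w ` P"])
    have cw: "card (w ` P) = E" using P E by (simp add: card_image)
    show "degree C < card (w ` P)"
      unfolding C_def cw using i by (intro degree_sum_less) (auto intro: le_less_trans[OF degree_monom_le])
    have "degree (L p) < E" if "p \<in> P" for p
    proof -
      have "degree (L p) \<le> (\<Sum>p'\<in>P - {p}. degree [:- w p', 1:])"
        unfolding L_def using P degree_prod_sum_le[of "P - {p}" "\<lambda>p'. [:- w p', 1:]"]
        by (simp add: comp_def)
      also have "\<dots> < E" using P E i that by simp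
      finally show ?thesis .
    qed
    then show "degree (\<Sum>p\<in>P. smult (r p / N p) (L p)) < card (w ` P)"
      unfolding cw using i by (intro degree_sum_less) (auto intro: le_less_trans[OF degree_smult_le])
    fix x assume "x \<in> w ` P"
    then obtain p where p: "p \<in> P" "x = w p" by auto
    have "poly (L p') x = 0" if "p' \<in> P - {p}" for p'
      using that p P by (auto simp: L_def poly_prod)
    then have "poly (\<Sum>p\<in>P. smult (r p / N p) (L p)) x = r p / N p * poly (L p) x"
      using p P by (simp add: poly_sum sum.remove[of P p])
    also have "poly (L p) x = N p"
      by (simp add: L_def N_def poly_prod p)
    finally show "poly C x = poly (\<Sum>p\<in>P. smult (r p / N p) (L p)) x"
      using N0 p c by (simp add: C_def poly_sum poly_monom)
  qed
  moreover have "coeff C i = c i"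
    using i by (simp add: C_def coeff_sum)
  ultimately have ci: "c i = (\<Sum>p\<in>P. r p / N p * coeff (L p) i)"
    by (simp add: coeff_sum)
  \<comment> \<open>Cancelling the denominator \<open>N p\<close> of a summand leaves the product of
    the other ones.\<close>
  have BN: "B = N p * (\<Prod>p'\<in>P - {p}. N p')" if "p \<in> P" for p
    using P that by (simp add: B N_def[symmetric] prod.remove)
  have "B * c i = (\<Sum>p\<in>P. B * (r p / N p * coeff (L p) i))"
    by (simp only: ci sum_distrib_left)
  also have "\<dots> = (\<Sum>p\<in>P. r p * (\<Prod>p'\<in>P - {p}. N p') * coeff (L p) i)"
    using N0 BN by (intro sum.cong refl) simp
  also have "\<dots> \<in> vals Z (d' + E * (E * d) + E * d)"
  proof (intro vals_sum vals_mult Z LV r)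
    fix p assume "p \<in> P"
    show "(\<Prod>p'\<in>P - {p}. N p') \<in> vals Z (E * (E * d))"
    proof (rule vals_mono[OF Z])
      show "(\<Prod>p'\<in>P - {p}. N p') \<in> vals Z (card (P - {p}) * (E * d))"
        using NV by (intro vals_prod Z) auto
      show "card (P - {p}) * (E * d) \<le> E * (E * d)"
        using P E card_mono[of P "P - {p}"] by (intro mult_right_mono) auto
    qed
  qed
  finally show "B * c i \<in> vals Z (d' + E * (E * d) + E * d)" .
qed

end

text \<open>Maps the points of \<open>F\<^sub>q\<^sup>k\<^sup>+\<^sup>1\<close> to \<open>F\<^sub>q\<close>. A few points are separated by all but few \<open>t\<close>, which reduces
  interpolation in several variables to Lagrange interpolation in one.\<close>

definition hash :: "nat \<Rightarrow> 'a::field \<Rightarrow> (nat \<Rightarrow> 'a) \<times> 'a \<Rightarrow> 'a" where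
  "hash k t p = snd p + (\<Sum>i<k. fst p i * t ^ Suc i)"

text \<open>The difference of the two hashes is a polynomial in \<open>t\<close> of degree at most
  \<open>k\<close> whose coefficients are the differences of the coordinates; extensionality makes
  it nonzero.\<close>

lemma card_hash_collision:
  assumes "p \<noteq> p'" "fst p \<in> extensional {..<k}" "fst p' \<in> extensional {..<k}"
  shows "finite {t. hash k t p = hash k t p'}" "card {t. hash k t p = hash k t p'} \<le> k"
proof -
  define q where "q = pCons (snd p - snd p') (\<Sum>i<k. monom (fst p i - fst p' i) i)"
  have q: "poly q t = hash k t p - hash k t p'" for t
    by (simp add: q_def hash_def poly_sum poly_monom sum_distrib_left sum_subtractf algebra_simps)
  have c0: "coeff q 0 = snd p - snd p'" by (simp add: q_def)
  have c1: "coeff q (Suc i) = (if i < k then fst p i - fst p' i else 0)" for i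
    by (simp add: q_def coeff_sum)
  have "q \<noteq> 0"
  proof
    assume "q = 0"
    then have "snd p = snd p'" "\<And>i. i < k \<Longrightarrow> fst p i = fst p' i"
      using c0 c1 by (auto split: if_splits) (metis coeff_0 eq_iff_diff_eq_0)
    then show False
      using assms extensionalityI[of "fst p" "{..<k}" "fst p'"] by (simp add: prod_eq_iff)
  qed
  moreover have "degree q \<le> k"
    by (rule degree_le) (metis c1 not_less_eq not_less_iff_gr_or_eq gr0_conv_Suc less_Suc_eq_0_disj)
  moreover have "{t. hash k t p = hash k t p'} = {t. poly q t = 0}"
    by (simp add: q)
  ultimately show "finite {t. hash k t p = hash k t p'}" "card {t. hash k t p = hash k t p'} \<le> k"
    using poly_roots_finite[of q] card_poly_roots_bound[of q] by auto
qed

text \<open>Union bound: each pair of different points collides for at most \<open>k\<close> values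
  of \<open>t\<close>.\<close>

lemma hash_injective_exists:
  assumes P: "finite P" "\<And>p. p \<in> P \<Longrightarrow> fst p \<in> extensional {..<k}"
    and T: "card T > card P * card P * k"
  shows "\<exists>t\<in>T. inj_on (hash k t) P"
proof (rule ccontr)
  assume no: "\<not> ?thesis"
  let ?D = "{(p, p') \<in> P \<times> P. p \<noteq> p'}"
  have D: "finite ?D" "card ?D \<le> card P * card P"
    using P by (auto intro: finite_subset[of _ "P \<times> P"] order.trans[OF card_mono[of "P \<times> P"]]
        simp: card_cartesian_product)
  have col: "finite {t. hash k t p = hash k t p'} \<and> card {t. hash k t p = hash k t p'} \<le> k"
    if "(p, p') \<in> ?D" for p p'
    using card_hash_collision[of p p' k] that P(2) by auto
  have "T \<subseteq> (\<Union>(p, p')\<in>?D. {t. hash k t p = hash k t p'})"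
    using no by (fastforce simp: inj_on_def)
  then have "card T \<le> card (\<Union>(p, p')\<in>?D. {t. hash k t p = hash k t p'})"
  proof (intro card_mono finite_UN_I D)
    fix x assume "x \<in> ?D"
    then show "finite (case x of (p, p') \<Rightarrow> {t. hash k t p = hash k t p'})"
      using col[of "fst x" "snd x"] by (simp add: case_prod_unfold)
  qed
  also have "\<dots> \<le> (\<Sum>(p, p')\<in>?D. card {t. hash k t p = hash k t p'})"
    using card_UN_le[OF D(1)] by (simp add: case_prod_unfold)
  also have "\<dots> \<le> (\<Sum>_\<in>?D. k)"
    using col by (intro sum_mono) auto
  also have "\<dots> \<le> card P * card P * k"
    using D by simp
  finally show False using T by simp
qed

section \<open>Fields of order a power of two\<close>

type_synonym F2bar = "bit alg_closure"

lemma F2bar_add_self: "x + x = (0 :: F2bar)"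
proof -
  have "x + x = to_ac (1 + 1 :: bit) * x"
    by (simp only: to_ac_add to_ac_1 distrib_right mult_1)
  also have "(1 + 1 :: bit) = 0" by (simp add: plus_bit_def zero_bit_def)
  finally show ?thesis by (simp only: to_ac_0 mult_zero_left)
qed

lemma F2bar_uminus: "- x = (x :: F2bar)"
  by (rule minus_unique[OF F2bar_add_self])

lemma F2bar_frobenius: "(x + y) ^ (2 ^ r) = x ^ (2 ^ r) + (y :: F2bar) ^ (2 ^ r)"
proof (induction r)
  case (Suc r)
  have sq: "(a + b)\<^sup>2 = a\<^sup>2 + b\<^sup>2" for a b :: F2bar
  proof -
    have "(a + b)\<^sup>2 = a\<^sup>2 + b\<^sup>2 + (a * b + a * b)"
      by (simp only: power2_eq_square algebra_simps)
    then show ?thesis by (simp only: F2bar_add_self add_0_right)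
  qed
  show ?case
    by (simp only: power_Suc2 power_mult Suc sq)
qed simp

text \<open>The fixed points of the \<open>r\<close>-fold Frobenius map, for
  \<open>r \<ge> 1\<close> the subfield of order \<open>2 ^ r\<close>.\<close>

definition gf :: "nat \<Rightarrow> F2bar set" where
  "gf r = {x. x ^ (2 ^ r) = x}"

lemma gf_closed: "1 \<in> gf r" "0 \<in> gf r"
  "x \<in> gf r \<Longrightarrow> y \<in> gf r \<Longrightarrow> x + y \<in> gf r"
  "x \<in> gf r \<Longrightarrow> y \<in> gf r \<Longrightarrow> x * y \<in> gf r"
  by (simp_all add: gf_def F2bar_frobenius power_mult_distrib)

lemma gf_power: "x \<in> gf r \<Longrightarrow> x ^ n \<in> gf r"
  by (induction n) (auto simp: gf_closed)

lemma gf_sum: "(\<And>i. i \<in> I \<Longrightarrow> f i \<in> gf r) \<Longrightarrow> (\<Sum>i\<in>I. f i) \<in> gf r"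
  by (induction I rule: infinite_finite_induct) (auto simp: gf_closed)

text \<open>The elements are the roots of \<open>p\<close>, which has degree \<open>2 ^ r\<close>
  and splits over the algebraic closure. Its derivative is \<open>- 1\<close>, so every root is
  simple and there are as many roots as the degree.\<close>

lemma gf_card:
  assumes "r \<ge> 1"
  shows "finite (gf r)" "card (gf r) = 2 ^ r"
proof -
  define p :: "F2bar poly" where "p = monom 1 (2 ^ r) - monom 1 1"
  have q: "2 ^ r > (1 :: nat)" using assms by (intro one_less_power) auto
  have deg: "degree p = 2 ^ r"
    unfolding p_def using q by (subst diff_conv_add_uminus, subst degree_add_eq_left) (auto simp: degree_monom_eq)
  then have p0: "p \<noteq> 0" using q by auto
  have gf: "gf r = {x. poly p x = 0}"
    by (auto simp: gf_def p_def poly_monom)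
  then show fin: "finite (gf r)" using poly_roots_finite[OF p0] by simp
  have "(2 :: F2bar) = 0" using F2bar_add_self[of 1] by simp
  then have "of_nat (2 ^ r) = (0 :: F2bar)" using assms by simp
  then have "pderiv p = - 1"
    using assms by (simp add: p_def pderiv_diff pderiv_monom flip: one_pCons)
  then have pd: "poly (pderiv p) x = - 1" for x by simp
  have ord: "order x p = 1" if "x \<in> gf r" for x
  proof (rule ccontr)
    have "order x p \<noteq> 0" using that p0 by (simp add: gf order_root)
    moreover assume "order x p \<noteq> 1"
    ultimately have "[:- x, 1:] ^ 2 dvd p"
      using p0 by (intro order_divides[THEN iffD2]) auto
    then obtain u where "p = [:- x, 1:] ^ 2 * u" by (rule dvdE)
    then have "p = [:- x, 1:] * ([:- x, 1:] * u)"
      by (simp only: power2_eq_square mult.assoc)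
    then have "poly (pderiv p) x = 0"
      by (simp only: pderiv_mult poly_add poly_mult) simp
    then show False using pd[of x] by simp
  qed
  obtain A where A: "size A = degree p" "p = smult (lead_coeff p) (\<Prod>x\<in>#A. [:- x, 1:])"
    using alg_closed_imp_factorization[OF p0] by blast
  have "(\<Prod>x\<in>#A. [:- x, 1:]) \<noteq> 0 \<and> proots (\<Prod>x\<in>#A. [:- x, 1:]) = A" for A :: "F2bar multiset"
  proof (induction A)
    case (add x A)
    then show ?case using proots_mult[of "[:- x, 1:]" "\<Prod>x\<in>#A. [:- x, 1:]"] by auto
  qed auto
  then have "proots p = A"
    by (subst A(2)) (use p0 in simp)
  then have "2 ^ r = size (proots p)"
    using A(1) deg by simp
  also have "\<dots> = (\<Sum>x\<in>gf r. 1)"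
    using ord p0 by (simp add: size_multiset_overloaded_eq gf)
  finally show "card (gf r) = 2 ^ r" by simp
qed

text \<open>Independence is taken over the prime field, whose size does not grow with
  \<open>r\<close>; this makes the bounds uniform in \<open>r\<close>.\<close>

interpretation F2: finite_coeff_ring "{0, 1 :: F2bar}"
  by unfold_locales (auto simp: F2bar_add_self F2bar_uminus)

section \<open>Graphs defined by generic polynomials\<close>

text \<open>Since an edge joining \<open>x\<close> to a vertex with first coordinate \<open>b\<close> corresponds to the point \<open>(x, b)\<close>,
  distinct edges are distinct points. Some \<open>h < H\<close> separates any given \<open>E\<close> of them, and then the \<open>E\<close>
  coefficients \<open>c j h i\<close>, \<open>i < E\<close>, are determined by the other ones.\<close>

definition nbr :: "nat \<Rightarrow> nat \<Rightarrow> nat \<Rightarrow> (nat \<Rightarrow> 'a::field) \<Rightarrow> (nat \<Rightarrow> nat \<Rightarrow> nat \<Rightarrow> 'a) \<Rightarrow>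
    (nat \<Rightarrow> 'a) \<Rightarrow> 'a \<Rightarrow> nat \<Rightarrow> 'a" where
  "nbr k H E lam c x b = (\<lambda>j\<in>{..<k}. if j = 0 then b
     else \<Sum>h<H. \<Sum>i<E. c j h i * hash k (lam h) (x, b) ^ i)"

text \<open>Index \<open>j\<close> starts at 1 because coordinate 0 of a neighbour is
  \<open>b\<close> itself. As this is a set, having as many elements as there are indices expresses
  that the parameters are distinct.\<close>

definition params :: "nat \<Rightarrow> nat \<Rightarrow> nat \<Rightarrow> (nat \<Rightarrow> 'a) \<Rightarrow> (nat \<Rightarrow> nat \<Rightarrow> nat \<Rightarrow> 'a) \<Rightarrow> 'a set" where
  "params k H E lam c = lam ` {..<H} \<union> (\<lambda>(j, h, i). c j h i) ` ({1..<k} \<times> {..<H} \<times> {..<E})"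

section \<open>Counting parameters against the conditions imposed by edges\<close>

context finite_coeff_ring
begin

text \<open>\<open>not_alg_indep\<close> is applied to the set \<open>Z\<close> of the
  \<open>lam h\<close>, the coordinates of \<open>W\<close> and the coefficients outside a slice
  \<open>h0\<close> whose hash separates \<open>P\<close>; interpolation recovers that slice.
  \<open>D\<close> is the bound of \<open>vals_interpolation\<close> for nodes of degree
  \<open>k + 1\<close> and values of degree \<open>E * (k + 1) + 1\<close>.\<close>

lemma params_not_alg_indep:
  assumes k: "k \<ge> 2" and E: "E = (2 * k + 1) * k" and H: "H > E * E * k"
    and lam: "inj_on lam {..<H}" and card0: "card (params k H E lam c) = H + (k - 1) * H * E"
    and P: "card P = E"
    and W: "finite W" "card W \<le> 2 + (2 * k + 1) * (k - 1)"
    and PW: "\<And>x b. (x, b) \<in> P \<Longrightarrow> x \<in> W \<and> x \<in> extensional {..<k} \<and> nbr k H E lam c x b \<in> W"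
    and T: "T \<subseteq> (\<Union>w\<in>W. w ` {..<k})" "card T = 2 * k + 1" "T \<inter> params k H E lam c = {}"
    and Y: "Y = params k H E lam c \<union> T"
    and D: "D = E * (k + 1) + 1 + E * (E * (k + 1)) + E * (k + 1)"
    and M: "M > (card Y * D + 1) ^ card Y"
  shows "\<not> alg_indep M Y"
proof -
  have "E > 0" using k E by simp
  then have finP: "finite P" using P card_ge_0_finite by auto
  obtain h0 where h0: "h0 < H" "inj_on (hash k (lam h0)) P"
    using hash_injective_exists[of P k "lam ` {..<H}"] finP PW P H lam
    by (force simp: card_image)
  define Zc where "Zc = (\<lambda>(j, h, i). c j h i) ` ({1..<k} \<times> ({..<H} - {h0}) \<times> {..<E})"
  define Zw where "Zw = (\<Union>w\<in>W. w ` {..<k})"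
  define Z where "Z = lam ` {..<H} \<union> Zw \<union> Zc"
  have Z: "finite Z" using W by (simp add: Z_def Zc_def Zw_def)
  have "card Zw \<le> (\<Sum>w\<in>W. card (w ` {..<k}))"
    unfolding Zw_def by (rule card_UN_le[OF W(1)])
  also have "\<dots> \<le> (\<Sum>w\<in>W. k)"
    by (intro sum_mono) (metis card_image_le card_lessThan finite_lessThan)
  also have "\<dots> = card W * k" by simp
  also have "\<dots> \<le> (2 + (2 * k + 1) * (k - 1)) * k"
    using W(2) by (rule mult_right_mono) simp
  finally have cW: "card Zw \<le> (2 + (2 * k + 1) * (k - 1)) * k" .
  have "card Zc \<le> card ({1..<k} \<times> ({..<H} - {h0}) \<times> {..<E})"
    unfolding Zc_def by (rule card_image_le) simp
  also have "\<dots> = (k - 1) * ((H - 1) * E)"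
    using h0 by (simp add: card_cartesian_product)
  finally have cC: "card Zc \<le> (k - 1) * ((H - 1) * E)" .
  have "card (lam ` {..<H}) = H" using lam by (simp add: card_image)
  then have "card Z \<le> H + card Zw + card Zc"
    unfolding Z_def using card_Un_le[of "lam ` {..<H} \<union> Zw" Zc] card_Un_le[of "lam ` {..<H}" Zw]
    by linarith
  also have "\<dots> \<le> H + (2 + (2 * k + 1) * (k - 1)) * k + (k - 1) * ((H - 1) * E)"
    using cW cC by linarith
  \<comment> \<open>By the choice of \<open>E\<close>, the \<open>(k - 1) * E\<close> indices of the
    removed slice cancel the summand \<open>(2 * k + 1) * (k - 1) * k\<close>. What remains is
    \<open>2 * k\<close>, one less than \<open>card T\<close>.\<close>
  also have "\<dots> = H + (k - 1) * H * E + 2 * k"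
  proof -
    obtain k' H' where "k = Suc k'" "H = Suc H'"
      using k H by (cases k; cases H) auto
    then show ?thesis by (simp add: E algebra_simps)
  qed
  also have "\<dots> < card Y"
    unfolding Y using card0 T k card_ge_0_finite[of T] card_ge_0_finite[of "params k H E lam c"] h0
    by (subst card_Un_disjoint) (auto simp: Int_commute)
  finally have ZY: "card Z < card Y" .

  define w where "w = hash k (lam h0)"
  define B where "B = (\<Prod>p\<in>P. \<Prod>p'\<in>P - {p}. w p - w p')"
  have gen: "z \<in> vals Z 1" if "z \<in> Z" for z
    using vals_gen[OF Z that] .
  have lamV: "lam h \<in> vals Z 1" if "h < H" for h
    using that by (intro gen) (auto simp: Z_def)
  have wV: "u i \<in> vals Z 1" if "u \<in> W" "i < k" for u i
    using that by (intro gen) (auto simp: Z_def Zw_def)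
  \<comment> \<open>Here \<open>b\<close> is coordinate 0 of a neighbour in \<open>W\<close>, and
    the summand \<open>x i * lam h ^ Suc i\<close> has degree at most \<open>k + 1\<close>.\<close>
  have hashV: "hash k (lam h) (x, b) \<in> vals Z (k + 1)" if p: "(x, b) \<in> P" and h: "h < H" for x b h
  proof -
    have "nbr k H E lam c x b 0 \<in> vals Z 1"
      using PW[OF p] k by (intro wV) auto
    then have b: "b \<in> vals Z (k + 1)"
      using k vals_mono[OF Z, of 1 "k + 1"] by (simp add: nbr_def)
    have "x i * lam h ^ Suc i \<in> vals Z (k + 1)" if "i < k" for i
    proof (rule vals_mono[OF Z])
      show "x i * lam h ^ Suc i \<in> vals Z (1 + Suc i * 1)"
        using PW[OF p] that by (intro vals_mult vals_power Z lamV wV h) auto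
    qed (use that in simp)
    then show ?thesis
      using b unfolding hash_def by (auto intro!: vals_add vals_sum)
  qed
  \<comment> \<open>Subtracting the terms with \<open>h \<noteq> h0\<close> from coordinate
    \<open>j\<close> leaves values of a univariate polynomial with coefficients
    \<open>c j h0 i\<close>. The nodes, and hence \<open>B\<close>, are the same for all
    \<open>j\<close>.\<close>
  have interp: "B \<noteq> 0 \<and> B \<in> vals Z (E * (E * (k + 1))) \<and>
      (\<forall>i<E. B * c j h0 i \<in> vals Z D)" if j: "1 \<le> j" "j < k" for j
  proof -
    define r where "r = (\<lambda>(x, b). nbr k H E lam c x b j -
      (\<Sum>h\<in>{..<H} - {h0}. \<Sum>i<E. c j h i * hash k (lam h) (x, b) ^ i))"
    have rV: "r p \<in> vals Z (E * (k + 1) + 1)" if "p \<in> P" for p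
    proof -
      obtain x b where p: "p = (x, b)" by (cases p)
      have "nbr k H E lam c x b j \<in> vals Z 1"
        using PW that j unfolding p by (intro wV) auto
      then have 1: "nbr k H E lam c x b j \<in> vals Z (E * (k + 1) + 1)"
        using vals_mono[OF Z, of 1 "E * (k + 1) + 1"] by simp
      have "c j h i * hash k (lam h) (x, b) ^ i \<in> vals Z (E * (k + 1) + 1)"
        if hi: "h \<in> {..<H} - {h0}" "i < E" for h i
      proof (rule vals_mono[OF Z])
        have "c j h i \<in> vals Z 1"
          using hi j by (intro gen) (force simp: Z_def Zc_def)
        then show "c j h i * hash k (lam h) (x, b) ^ i \<in> vals Z (1 + i * (k + 1))"
          using hi \<open>p \<in> P\<close> unfolding p by (intro vals_mult vals_power hashV Z) auto
        have "i * (k + 1) \<le> E * (k + 1)" using hi(2) by (intro mult_right_mono) auto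
        then show "1 + i * (k + 1) \<le> E * (k + 1) + 1" by linarith
      qed
      then show ?thesis
        using 1 unfolding r_def p by (auto intro!: vals_diff vals_sum)
    qed
    have eq: "(\<Sum>i<E. c j h0 i * w p ^ i) = r p" if "p \<in> P" for p
      using j h0(1) by (cases p) (simp add: r_def nbr_def w_def sum.remove[of "{..<H}" h0])
    have wV': "w p \<in> vals Z (k + 1)" if "p \<in> P" for p
      using hashV[of "fst p" "snd p"] that h0 by (simp add: w_def)
    note I = vals_interpolation[OF Z finP h0(2)[folded w_def] wV' rV P eq B_def]
    show ?thesis
      using I by (simp add: D)
  qed
  have B: "B \<noteq> 0" "B \<in> vals Z (E * (E * (k + 1)))"
    using interp[of 1] k by auto
  show ?thesis
  proof (rule not_alg_indep[OF Z ZY _ B(1) _ M])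
    show "B \<in> vals Z D"
      by (rule vals_mono[OF Z _ B(2)]) (simp add: D)
    have BZ: "B * z \<in> vals Z D" if "z \<in> Z" for z
      by (rule vals_mono[OF Z _ vals_mult[OF Z B(2) gen[OF that]]]) (simp add: D)
    fix y assume "y \<in> Y"
    then consider "y \<in> T" | "y \<in> lam ` {..<H}"
      | j h i where "j \<in> {1..<k}" "h \<in> {..<H}" "i \<in> {..<E}" "y = c j h i"
      unfolding Y params_def by (elim UnE imageE) (auto simp: Ball_def)
    then show "B * y \<in> vals Z D"
    proof cases
      case 1
      then show ?thesis using T(1) BZ by (auto simp: Z_def Zw_def)
    next
      case 2
      then show ?thesis using BZ by (simp add: Z_def)
    next
      case (3 j h i)
      show ?thesis
      proof (cases "h = h0")
        case True
        then show ?thesis using 3 interp[of j] by auto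
      next
        case False
        then have "y \<in> Zc" unfolding Zc_def using 3 by (intro image_eqI[of _ _ "(j, h, i)"]) auto
        then show ?thesis using BZ by (simp add: Z_def)
      qed
    qed
  qed
qed

end

text \<open>The tag separates the two sides. Each edge occurs once, directed from the side
  \<open>False\<close> to the side \<open>True\<close>, so the cardinality is the number of
  edges.\<close>

definition poly_arcs :: "nat \<Rightarrow> 'a set \<Rightarrow> nat \<Rightarrow> nat \<Rightarrow> (nat \<Rightarrow> 'a::field) \<Rightarrow> (nat \<Rightarrow> nat \<Rightarrow> nat \<Rightarrow> 'a) \<Rightarrow>
    ((bool \<times> (nat \<Rightarrow> 'a)) \<times> (bool \<times> (nat \<Rightarrow> 'a))) set" where
  "poly_arcs k F H E lam c =
     (\<lambda>(x, b). ((False, x), (True, nbr k H E lam c x b))) ` (({..<k} \<rightarrow>\<^sub>E F) \<times> F)"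

text \<open>For \<open>k \<ge> 2\<close> every edge has an inner vertex, which names its
  path.\<close>

lemma theta_path_edge_unique:
  assumes "k \<ge> 2" "j < k" "j' < k"
    "{theta_path k i j, theta_path k i (Suc j)} = {theta_path k i' j', theta_path k i' (Suc j')}"
  shows "i = i' \<and> j = j'"
  using assms by (auto simp: theta_path_def doubleton_eq_iff split: if_splits)

lemma theta_simps:
  "pverts (theta k l) = {Source, Target} \<union> {theta_path k i j | i j. i < l \<and> j \<le> k}"
  "parcs (theta k l) = {(theta_path k i j, theta_path k i (Suc j)) | i j. i < l \<and> j < k} \<union>
     {(theta_path k i j, theta_path k i (Suc j)) | i j. i < l \<and> j < k}\<inverse>"
  by (simp_all add: theta_def Let_def)

lemma theta_path_vert: "i < l \<Longrightarrow> j \<le> k \<Longrightarrow> theta_path k i j \<in> pverts (theta k l)"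
  by (auto simp: theta_simps)

lemma theta_path_arc:
  "i < l \<Longrightarrow> j < k \<Longrightarrow> (theta_path k i j, theta_path k i (Suc j)) \<in> parcs (theta k l)"
  by (auto simp: theta_simps)

lemma poly_arcs_E:
  assumes "(u, v) \<in> poly_arcs k F H E lam c \<union> (poly_arcs k F H E lam c)\<inverse>"
  obtains x b where "x \<in> extensional {..<k}"
    "u = (False, x) \<and> v = (True, nbr k H E lam c x b) \<or>
     v = (False, x) \<and> u = (True, nbr k H E lam c x b)"
proof -
  have *: "\<exists>x b. x \<in> extensional {..<k} \<and> u = (False, x) \<and> v = (True, nbr k H E lam c x b)"
    if uv: "(u, v) \<in> poly_arcs k F H E lam c" for u v
  proof -
    obtain p where p: "p \<in> ({..<k} \<rightarrow>\<^sub>E F) \<times> F"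
      "(u, v) = (case p of (x, b) \<Rightarrow> ((False, x), (True, nbr k H E lam c x b)))"
      using uv unfolding poly_arcs_def by (rule imageE)
    then show ?thesis
      by (intro exI[of _ "fst p"] exI[of _ "snd p"]) (auto simp: PiE_def case_prod_unfold)
  qed
  consider "(u, v) \<in> poly_arcs k F H E lam c" | "(v, u) \<in> poly_arcs k F H E lam c"
    using assms by blast
  then show ?thesis
    by cases (use *[of u v] *[of v u] that in blast)+
qed

section \<open>Absence of theta graphs\<close>

context finite_coeff_ring
begin

text \<open>The first inner vertices go to \<open>l\<close> different neighbours of the image of
  \<open>Source\<close>, all on one side, so their vectors are distinct and
  \<open>alg_indep_extend_coords\<close> selects \<open>2 * k + 1\<close> paths. Their edges form
  the set \<open>P\<close> for \<open>params_not_alg_indep\<close>, which contradicts the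
  independence obtained.\<close>

lemma poly_graph_theta_free:
  assumes k: "k \<ge> 2" and E: "E = (2 * k + 1) * k" and H: "H > E * E * k"
    and lam: "inj_on lam {..<H}" and a: "a = H + (k - 1) * H * E"
    and card0: "card (params k H E lam c) = a"
    and D: "D = E * (k + 1) + 1 + E * (E * (k + 1)) + E * (k + 1)"
    and M: "M > ((a + (2 * k + 1)) * D + 1) ^ (a + (2 * k + 1))"
    and ind: "alg_indep M (params k H E lam c)"
    and l: "l \<ge> 2 * k + 1 + algebraic_bound M (a + (2 * k + 1)) ^ k"
    and f: "inj_on f (pverts (theta k l))"
    and arcs: "\<And>u v. (u, v) \<in> parcs (theta k l) \<Longrightarrow>
      (f u, f v) \<in> poly_arcs k F H E lam c \<union> (poly_arcs k F H E lam c)\<inverse>"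
  shows False
proof -
  let ?A = "poly_arcs k F H E lam c" and ?Y0 = "params k H E lam c" and ?s = "2 * k + 1"
  have first: "Inner i 1 \<in> pverts (theta k l)" "(Source, Inner i 1) \<in> parcs (theta k l)" if "i < l" for i
  proof -
    have "theta_path k i 0 = Source" "theta_path k i (Suc 0) = Inner i 1"
      using k by (auto simp: theta_path_def)
    moreover have "theta_path k i (Suc 0) \<in> pverts (theta k l)"
      using that k by (intro theta_path_vert) auto
    moreover have "(theta_path k i 0, theta_path k i (Suc 0)) \<in> parcs (theta k l)"
      using that k by (intro theta_path_arc) auto
    ultimately show "Inner i 1 \<in> pverts (theta k l)" "(Source, Inner i 1) \<in> parcs (theta k l)"
      by simp_all
  qed
  define v where "v i = snd (f (Inner i 1))" for i
  have side: "fst (f (Inner i 1)) = (\<not> fst (f Source)) \<and> v i \<in> extensional {..<k}" if "i < l" for i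
    using arcs[OF first(2)[OF that]]
  proof (rule poly_arcs_E)
    fix x b
    have "nbr k H E lam c x b \<in> extensional {..<k}" by (simp add: nbr_def)
    moreover assume "x \<in> extensional {..<k}"
      "f Source = (False, x) \<and> f (Inner i 1) = (True, nbr k H E lam c x b) \<or>
       f (Inner i 1) = (False, x) \<and> f Source = (True, nbr k H E lam c x b)"
    ultimately show ?thesis unfolding v_def by (elim disjE conjE) simp_all
  qed
  have vinj: "inj_on v {..<l}"
  proof (rule inj_onI)
    fix i i' assume i: "i \<in> {..<l}" "i' \<in> {..<l}" "v i = v i'"
    then have "f (Inner i 1) = f (Inner i' 1)"
      using side[of i] side[of i'] by (simp add: v_def prod_eq_iff)
    then have "Inner i 1 = Inner i' 1"
      using inj_onD[OF f] first(1) i by blast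
    then show "i = i'" by simp
  qed
  obtain S T where ST: "S \<subseteq> {..<l}" "card S = ?s" "finite T" "card T = ?s" "T \<inter> ?Y0 = {}"
    "alg_indep M (?Y0 \<union> T)" "T \<subseteq> (\<Union>i\<in>S. v i ` {..<k})"
    using alg_indep_extend_coords[OF ind _ vinj, of "{..<k}" ?s] side l by (auto simp: card0)
  have finS: "finite S" using ST(1) finite_subset by blast
  define V where "V = {Source, Target} \<union> (\<lambda>(i, j). Inner i j) ` (S \<times> {1..<k})"
  \<comment> \<open>Forgetting the side may identify vertices; only an upper bound for
    \<open>card W\<close> is used.\<close>
  define W where "W = (\<lambda>u. snd (f u)) ` V"
  have finV: "finite V" using finS by (simp add: V_def)
  have "card V \<le> card {Source, Target} + card ((\<lambda>(i, j). Inner i j) ` (S \<times> {1..<k}))"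
    unfolding V_def by (rule card_Un_le)
  also have "\<dots> \<le> 2 + card (S \<times> {1..<k})"
    using finS by (intro add_mono card_image_le) auto
  also have "\<dots> = 2 + ?s * (k - 1)"
    by (simp only: card_cartesian_product ST(2) card_atLeastLessThan)
  finally have W: "finite W" "card W \<le> 2 + ?s * (k - 1)"
    unfolding W_def using card_image_le[OF finV, of "\<lambda>u. snd (f u)"] finV by auto
  have pathV: "theta_path k i j \<in> V" "theta_path k i j \<in> pverts (theta k l)" if "i \<in> S" "j \<le> k" for i j
    using that ST(1) by (auto simp: V_def theta_path_def theta_simps)
  define ends where "ends ij = (case ij of (i, j) \<Rightarrow> {theta_path k i j, theta_path k i (Suc j)})" for ij
  \<comment> \<open>A path traverses edges in both directions between the sides, so a point
    \<open>(x, b)\<close> is attached to the unordered pair of ends.\<close>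
  have "\<exists>p. fst p \<in> extensional {..<k} \<and>
      f ` ends ij = {(False, fst p), (True, nbr k H E lam c (fst p) (snd p))}"
    if mem: "ij \<in> S \<times> {..<k}" for ij
  proof -
    obtain i j where ij: "ij = (i, j)" "i \<in> S" "j < k" "i < l"
      using mem ST(1) by (cases ij) auto
    obtain x b where xb: "x \<in> extensional {..<k}"
      "f (theta_path k i j) = (False, x) \<and> f (theta_path k i (Suc j)) = (True, nbr k H E lam c x b) \<or>
       f (theta_path k i (Suc j)) = (False, x) \<and> f (theta_path k i j) = (True, nbr k H E lam c x b)"
      using arcs[OF theta_path_arc[OF ij(4,3)]] by (rule poly_arcs_E)
    then have "f ` ends ij = {(False, x), (True, nbr k H E lam c x b)}"
      by (elim disjE conjE) (simp_all add: ends_def ij(1) insert_commute)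
    then show ?thesis
      using xb(1) by (intro exI[of _ "(x, b)"]) simp
  qed
  then obtain pt where pt: "\<And>ij. ij \<in> S \<times> {..<k} \<Longrightarrow> fst (pt ij) \<in> extensional {..<k} \<and>
      f ` ends ij = {(False, fst (pt ij)), (True, nbr k H E lam c (fst (pt ij)) (snd (pt ij)))}"
    by metis
  have ends: "ends ij \<subseteq> V" "ends ij \<subseteq> pverts (theta k l)" if "ij \<in> S \<times> {..<k}" for ij
    using that pathV by (auto simp: ends_def)
  \<comment> \<open>A point determines the image of its edge, hence the edge as \<open>f\<close> is
    injective, hence path and position.\<close>
  have "inj_on pt (S \<times> {..<k})"
  proof (rule inj_onI)
    fix ij ij' assume ij: "ij \<in> S \<times> {..<k}" "ij' \<in> S \<times> {..<k}" "pt ij = pt ij'"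
    have "f ` ends ij = f ` ends ij'"
      using pt[OF ij(1)] pt[OF ij(2)] unfolding ij(3) by (elim conjE) (simp only:)
    then have "ends ij = ends ij'"
      using inj_on_image_eq_iff[OF f ends(2)[OF ij(1)] ends(2)[OF ij(2)]] by (simp only: simp_thms)
    moreover obtain i j i' j' where p: "ij = (i, j)" "ij' = (i', j')"
      by (cases ij, cases ij')
    ultimately have "{theta_path k i j, theta_path k i (Suc j)} = {theta_path k i' j', theta_path k i' (Suc j')}"
      by (simp only: ends_def prod.case)
    then have "i = i' \<and> j = j'"
      using theta_path_edge_unique[OF k, of j j' i i'] ij(1,2) unfolding p by simp
    then show "ij = ij'" by (simp add: p)
  qed
  then have P: "card (pt ` (S \<times> {..<k})) = E"
    by (simp only: card_image card_cartesian_product ST(2) card_lessThan E)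
  have PW: "x \<in> W \<and> x \<in> extensional {..<k} \<and> nbr k H E lam c x b \<in> W"
    if "(x, b) \<in> pt ` (S \<times> {..<k})" for x b
  proof -
    from that obtain ij where ij: "ij \<in> S \<times> {..<k}" "(x, b) = pt ij" by auto
    then have eq: "f ` ends ij = {(False, x), (True, nbr k H E lam c x b)}"
      and x: "x \<in> extensional {..<k}"
      using pt[OF ij(1)] unfolding ij(2)[symmetric] fst_conv snd_conv by blast+
    have "{(False, x), (True, nbr k H E lam c x b)} \<subseteq> f ` V"
      using ends(1)[OF ij(1)] by (simp only: eq[symmetric] image_mono)
    then have "snd ` {(False, x), (True, nbr k H E lam c x b)} \<subseteq> W"
      unfolding W_def image_image[symmetric] by (rule image_mono)
    then show ?thesis using x by simp
  qed
  have "v i \<in> W" if "i \<in> S" for i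
  proof -
    have "Inner i 1 \<in> V"
      unfolding V_def using that k by (intro UnI2 image_eqI[of _ _ "(i, 1)"]) auto
    then show ?thesis unfolding v_def W_def by (rule imageI)
  qed
  then have TW: "T \<subseteq> (\<Union>w\<in>W. w ` {..<k})"
    using ST(7) by blast
  have finY0: "finite ?Y0" using ind by (simp add: alg_indep_def)
  have "card (?Y0 \<union> T) = a + ?s"
    using ST finY0 card0 by (simp add: card_Un_disjoint Int_commute)
  then have "\<not> alg_indep M (?Y0 \<union> T)"
    using params_not_alg_indep[OF k E H lam _ P W PW TW ST(4,5) refl D] M a card0 by simp
  then show False using ST(6) by simp
qed

end

text \<open>Coordinate 0 of the neighbour is \<open>b\<close>, so different pairs
  \<open>(x, b)\<close> give different arcs.\<close>

lemma poly_arcs_card: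
  fixes F :: "'a::field set"
  assumes F: "finite F" and k: "k \<ge> 1"
  shows "finite (poly_arcs k F H E lam c)" "card (poly_arcs k F H E lam c) = card F ^ Suc k"
proof -
  show "finite (poly_arcs k F H E lam c)"
    unfolding poly_arcs_def using F by (intro finite_imageI finite_SigmaI finite_PiE) auto
  have "inj_on (\<lambda>(x, b). ((False, x), (True, nbr k H E lam c x b))) (({..<k} \<rightarrow>\<^sub>E F) \<times> F)"
  proof (rule inj_onI)
    fix p p' assume "(case p of (x, b) \<Rightarrow> ((False, x), (True, nbr k H E lam c x b))) =
      (case p' of (x, b) \<Rightarrow> ((False, x), (True, nbr k H E lam c x b)))"
    moreover obtain x b x' b' where p: "p = (x, b)" "p' = (x', b')"
      by (cases p, cases p')
    ultimately have "x = x'" "nbr k H E lam c x b 0 = nbr k H E lam c x' b' 0"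
      by auto
    then show "p = p'" using p k by (simp add: nbr_def)
  qed
  then show "card (poly_arcs k F H E lam c) = card F ^ Suc k"
    using F by (simp add: poly_arcs_def card_image card_cartesian_product card_PiE)
qed

lemma poly_arcs_verts:
  assumes k: "k \<ge> 1" and F: "params k H E lam c \<subseteq> gf r"
  shows "poly_arcs k (gf r) H E lam c \<subseteq> ({False} \<times> ({..<k} \<rightarrow>\<^sub>E gf r)) \<times> ({True} \<times> ({..<k} \<rightarrow>\<^sub>E gf r))"
proof -
  have "nbr k H E lam c x b \<in> {..<k} \<rightarrow>\<^sub>E gf r" if x: "x \<in> {..<k} \<rightarrow>\<^sub>E gf r" and b: "b \<in> gf r" for x b
  proof -
    have l: "lam h \<in> gf r" if "h < H" for h
      using F that by (auto simp: params_def)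
    have c: "c j h i \<in> gf r" if "j \<in> {1..<k}" "h < H" "i < E" for j h i
      using F that by (force simp: params_def)
    have hash: "hash k (lam h) (x, b) \<in> gf r" if "h < H" for h
      unfolding hash_def fst_conv snd_conv
      by (intro gf_closed(3,4) gf_sum gf_power l that b) (use x in \<open>auto simp: PiE_iff\<close>)
    have "(\<Sum>h<H. \<Sum>i<E. c j h i * hash k (lam h) (x, b) ^ i) \<in> gf r" if "j \<in> {1..<k}" for j
      by (intro gf_closed(3,4) gf_sum gf_power c hash that) auto
    then show ?thesis
      using b by (auto simp: nbr_def)
  qed
  then show ?thesis by (auto simp: poly_arcs_def)
qed

section \<open>The extremal number\<close>

text \<open>Ensures that a copy of the theta graph avoids isolated vertices of the host
  graph.\<close>

lemma theta_vertex_arc: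
  assumes "k \<ge> 1" "l \<ge> 1" "u \<in> pverts (theta k l)"
  shows "\<exists>v. (u, v) \<in> parcs (theta k l) \<or> (v, u) \<in> parcs (theta k l)"
proof -
  have "u \<in> {theta_path k 0 0, theta_path k 0 k} \<union> {theta_path k i j | i j. i < l \<and> j \<le> k}"
    using assms(1,3) by (simp add: theta_simps theta_path_def)
  then obtain i j where ij: "u = theta_path k i j" "i < l" "j \<le> k"
    using assms(2) by fastforce
  show ?thesis
  proof (cases "j < k")
    case True
    then show ?thesis using theta_path_arc[OF ij(2) True] ij(1) by blast
  next
    case False
    then have "j = Suc (k - 1)" "k - 1 < k" using ij(3) assms(1) by auto
    then show ?thesis using theta_path_arc[OF ij(2), of "k - 1" k] ij(1) by metis
  qed
qed

lemma extremal_number_ge: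
  fixes G :: "nat pair_pre_digraph"
  assumes H: "pair_graph H" and G: "pair_graph G" and card: "card (pverts G) = n"
    and ne: "parcs H \<noteq> {}"
    and no: "\<not> contains_copy G H"
  shows "card (uedges G) \<le> extremal_number n H"
proof -
  have "G \<in> free_graphs n H"
    using G card no by (simp add: free_graphs_def)
  then show ?thesis
    unfolding extremal_number_def
    by (intro Max_ge extremal_number_attained(1)[OF H ne] imageI)
qed

lemma extremal_number_theta_ge:
  fixes A :: "('v \<times> 'v) set"
  assumes k: "k \<ge> 1" and l: "l \<ge> 1"
    and V: "finite V" "card V \<le> n" and A: "A \<subseteq> V \<times> V" "A \<inter> A\<inverse> = {}" "\<And>u. (u, u) \<notin> A"
    and free: "\<And>f. inj_on f (pverts (theta k l)) \<Longrightarrow>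
      (\<And>u v. (u, v) \<in> parcs (theta k l) \<Longrightarrow> (f u, f v) \<in> A \<union> A\<inverse>) \<Longrightarrow> False"
  shows "card A \<le> extremal_number n (theta k l)"
proof -
  obtain g :: "'v \<Rightarrow> nat" where g: "g ` V \<subseteq> {..<n}" "inj_on g V"
    using card_le_inj[of V "{..<n}"] V by auto
  define G where "G = \<lparr> pverts = {..<n}, parcs = map_prod g g ` (A \<union> A\<inverse>) \<rparr>"
  have AV: "A \<union> A\<inverse> \<subseteq> V \<times> V" using A(1) by auto
  have finA: "finite A" using A(1) V(1) finite_subset by blast
  have gA: "u \<in> V \<and> v \<in> V \<and> g u \<noteq> g v" if "(u, v) \<in> A \<union> A\<inverse>" for u v
    using that AV A(3) inj_onD[OF g(2), of u v] by auto
  have G: "pair_graph G"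
  proof
    fix e assume "e \<in> parcs G"
    then obtain u v where e: "e = (g u, g v)" "(u, v) \<in> A \<union> A\<inverse>" by (auto simp: G_def)
    show "fst e \<in> pverts G" "snd e \<in> pverts G" "fst e \<noteq> snd e"
      using gA[OF e(2)] g(1) by (auto simp: e(1) G_def)
  next
    show "finite (pverts G)" "finite (parcs G)"
      using finA by (auto simp: G_def)
    show "symmetric (with_proj G)"
      by (auto simp: symmetric_def sym_def G_def)
  qed
  have "\<not> contains_copy G (theta k l)"
  proof
    assume "contains_copy G (theta k l)"
    then obtain f where f: "inj_on f (pverts (theta k l))"
      "\<And>u v. (u, v) \<in> parcs (theta k l) \<Longrightarrow> (f u, f v) \<in> parcs G"
      unfolding contains_copy_iff[OF G pair_graph_theta] by blast
    define f' where "f' u = inv_into V g (f u)" for u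
    have arcs: "(f' u, f' v) \<in> A \<union> A\<inverse> \<and> f u = g (f' u) \<and> f v = g (f' v)"
      if uv: "(u, v) \<in> parcs (theta k l)" for u v
    proof -
      obtain a b where ab: "f u = g a" "f v = g b" "(a, b) \<in> A \<union> A\<inverse>"
        using f(2)[OF uv] by (auto simp: G_def)
      then show ?thesis
        using gA[OF ab(3)] by (simp add: f'_def inv_into_f_f[OF g(2)])
    qed
    have "f u = g (f' u)" if "u \<in> pverts (theta k l)" for u
      using theta_vertex_arc[OF k l that] arcs by blast
    then have "inj_on f' (pverts (theta k l))"
      using f(1) by (metis inj_on_def)
    then show False
      using free[of f'] arcs by blast
  qed
  then have "card (uedges G) \<le> extremal_number n (theta k l)"
    using theta_path_arc[of 0 l 0 k] k l by (intro extremal_number_ge pair_graph_theta G) (auto simp: G_def)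
  moreover have "card A \<le> card (uedges G)"
  proof (rule card_inj_on_le)
    show "inj_on (\<lambda>(u, v). {g u, g v}) A"
    proof (rule inj_onI)
      fix a a' assume a: "a \<in> A" "a' \<in> A" "(case a of (u, v) \<Rightarrow> {g u, g v}) = (case a' of (u, v) \<Rightarrow> {g u, g v})"
      obtain u v u' v' where uv: "a = (u, v)" "a' = (u', v')" by (cases a, cases a')
      have V4: "u \<in> V" "v \<in> V" "u' \<in> V" "v' \<in> V" using a A(1) uv by auto
      have "{g u, g v} = {g u', g v'}" using a(3) uv by simp
      \<comment> \<open>The second alternative is excluded since \<open>A\<close> contains no arc
        together with its reverse.\<close>
      then have "u = u' \<and> v = v' \<or> u = v' \<and> v = u'"
        using V4 by (auto simp: doubleton_eq_iff inj_on_eq_iff[OF g(2)])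
      then show "a = a'" using a A(2) uv by auto
    qed
    show "(\<lambda>(u, v). {g u, g v}) ` A \<subseteq> uedges G"
      by (force simp: uedges_def G_def)
    show "finite (uedges G)" using finA by (simp add: uedges_def G_def)
  qed
  ultimately show ?thesis by linarith
qed

section \<open>Choice of the constants and passage to all \<open>n\<close>\<close>

lemma extremal_number_theta_power_of_two:
  assumes k: "k \<ge> 2"
  shows "\<exists>l q0 :: nat. l \<ge> 1 \<and> (\<forall>r n. 2 ^ r \<ge> q0 \<longrightarrow> n \<ge> 2 * (2 ^ r) ^ k \<longrightarrow>
    (2 ^ r) ^ Suc k \<le> extremal_number n (theta k l))"
proof -
  \<comment> \<open>All constants depend on \<open>k\<close> alone and are fixed before
    \<open>r\<close>. In \<open>q0\<close>, the \<open>Suc\<close> gives a strict inequality and the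
    \<open>+ 2\<close> excludes \<open>r = 0\<close>.\<close>
  define E where "E = (2 * k + 1) * k"
  define H where "H = Suc (E * E * k)"
  define a where "a = H + (k - 1) * H * E"
  define D where "D = E * (k + 1) + 1 + E * (E * (k + 1)) + E * (k + 1)"
  define M where "M = Suc (((a + (2 * k + 1)) * D + 1) ^ (a + (2 * k + 1)))"
  define l where "l = 2 * k + 1 + F2.algebraic_bound M (a + (2 * k + 1)) ^ k"
  define q0 where "q0 = Suc (F2.algebraic_bound M a) + 2"
  have l: "l \<ge> 1" by (simp add: l_def)
  have "(2 ^ r) ^ Suc k \<le> extremal_number n (theta k l)"
    if r: "2 ^ r \<ge> q0" and n: "n \<ge> 2 * (2 ^ r) ^ k" for r n
  proof -
    have r1: "r \<ge> 1" using r by (cases r) (auto simp: q0_def)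
    note gf = gf_card[OF r1]
    have "card (gf r) > F2.algebraic_bound M a" using r gf by (simp add: q0_def)
    then obtain Y where Y: "Y \<subseteq> gf r" "card Y = a" "F2.alg_indep M Y"
      using F2.alg_indep_exists[OF gf(1)] by blast
    \<comment> \<open>The disjoint sum indexes all parameters; a bijection onto \<open>Y\<close>
      names its elements \<open>lam h\<close> and \<open>c j h i\<close>.\<close>
    let ?I = "{..<H} <+> ({1..<k} \<times> {..<H} \<times> {..<E})"
    have "card ?I = card Y"
      by (simp add: card_Plus card_cartesian_product Y a_def mult.assoc)
    moreover have "finite Y" using Y gf finite_subset by blast
    ultimately obtain g where g: "bij_betw g ?I Y"
      using finite_same_card_bij[of ?I Y] by auto
    define lam where "lam h = g (Inl h)" for h
    define c where "c j h i = g (Inr (j, h, i))" for j h i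
    have par: "params k H E lam c = Y"
    proof -
      have "params k H E lam c = g ` ?I"
        by (simp add: params_def lam_def c_def Plus_def image_Un image_image case_prod_unfold)
      then show ?thesis using g by (simp add: bij_betw_def)
    qed
    have lam: "inj_on lam {..<H}"
      using bij_betw_imp_inj_on[OF g] by (auto simp: inj_on_def lam_def)
    define A where "A = poly_arcs k (gf r) H E lam c"
    define V where "V = (UNIV :: bool set) \<times> ({..<k} \<rightarrow>\<^sub>E gf r)"
    have A: "A \<subseteq> ({False} \<times> ({..<k} \<rightarrow>\<^sub>E gf r)) \<times> ({True} \<times> ({..<k} \<rightarrow>\<^sub>E gf r))"
      unfolding A_def using k Y(1) par by (intro poly_arcs_verts) auto
    have "card A \<le> extremal_number n (theta k l)"
    proof (rule extremal_number_theta_ge[OF _ l])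
      show "k \<ge> 1" using k by simp
      show "finite V" using gf by (auto simp: V_def intro!: finite_PiE)
      show "card V \<le> n"
        using n by (simp add: V_def card_cartesian_product card_PiE gf)
      show "A \<subseteq> V \<times> V" using A by (auto simp: V_def)
      show "A \<inter> A\<inverse> = {}" "(u, u) \<notin> A" for u using A by auto
      fix f assume f: "inj_on f (pverts (theta k l))"
        "\<And>u v. (u, v) \<in> parcs (theta k l) \<Longrightarrow> (f u, f v) \<in> A \<union> A\<inverse>"
      show False
      proof (rule F2.poly_graph_theta_free[OF k E_def _ lam a_def _ D_def _ _ _ f(1)])
        show "E * E * k < H" by (simp add: H_def)
        show "card (params k H E lam c) = a" by (simp add: par Y)
        show "((a + (2 * k + 1)) * D + 1) ^ (a + (2 * k + 1)) < M" by (simp add: M_def)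
        show "F2.alg_indep M (params k H E lam c)" by (simp add: par Y)
        show "2 * k + 1 + F2.algebraic_bound M (a + (2 * k + 1)) ^ k \<le> l" by (simp add: l_def)
      qed (rule f(2)[unfolded A_def])
    qed
    then show ?thesis
      using poly_arcs_card(2)[of "gf r" k H E lam c] gf k by (simp add: A_def)
  qed
  then show ?thesis using l by (intro exI[of _ l] exI[of _ q0]) simp
qed

theorem theorem1:
  fixes k :: nat
  assumes "k \<ge> 2"
  shows "\<exists>l::nat. l \<ge> 1 \<and> (\<exists>c::real. c > 0 \<and>
           (\<forall>\<^sub>F n in sequentially.
              real (extremal_number n (theta k l)) \<ge> c * real n powr (1 + 1 / real k)))"
proof -
  obtain l q0 :: nat where l: "l \<ge> 1" and bnd: "\<forall>r n. 2 ^ r \<ge> q0 \<longrightarrow> n \<ge> 2 * (2 ^ r) ^ k \<longrightarrow>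
    (2 ^ r) ^ Suc k \<le> extremal_number n (theta k l)"
    using extremal_number_theta_power_of_two[OF assms] by (elim exE conjE)
  \<comment> \<open>For the largest \<open>r\<close> with \<open>2 * (2 ^ r) ^ k \<le> n\<close>,
    the quotient \<open>n / 2 ^ Suc k\<close> is below \<open>(2 ^ r) ^ k\<close>; raising this to
    the power \<open>1 + 1 / k\<close> gives the factor \<open>c\<close>.\<close>
  define c :: real where "c = (1 / 2 ^ Suc k) powr (1 + 1 / real k)"
  have bound: "real (extremal_number n (theta k l)) \<ge> c * real n powr (1 + 1 / real k)"
    if n: "n \<ge> 2 * (2 ^ q0) ^ k" for n
  proof -
    \<comment> \<open>The lower bound on \<open>n\<close> puts \<open>q0\<close> into
      \<open>R\<close>, so the maximum exists and is at least \<open>q0\<close>, whence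
      \<open>2 ^ r \<ge> q0\<close>.\<close>
    define R where "R = {r. 2 * (2 ^ r) ^ k \<le> n}"
    have "r \<le> n" if "r \<in> R" for r
    proof -
      have "r < 2 ^ r" by (rule less_exp)
      also have "\<dots> \<le> (2 ^ r) ^ k" using assms by (intro self_le_power) auto
      finally show ?thesis using that by (simp add: R_def)
    qed
    then have finR: "finite R" by (intro finite_subset[of R "{..n}"]) auto
    define r where "r = Max R"
    have q0R: "q0 \<in> R" using n by (simp add: R_def)
    have "r \<in> R" unfolding r_def using finR q0R by (intro Max_in) auto
    then have rn: "2 * (2 ^ r) ^ k \<le> n" by (simp add: R_def)
    have "Suc r \<notin> R" using Max_ge[OF finR, of "Suc r"] by (auto simp: r_def)
    then have "n < 2 * (2 ^ Suc r) ^ k" by (simp add: R_def)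
    also have "\<dots> = 2 ^ Suc k * (2 ^ r) ^ k" by (simp add: power_mult_distrib)
    finally have nr: "n < 2 ^ Suc k * (2 ^ r) ^ k" .
    have "q0 \<le> r" unfolding r_def using finR q0R by simp
    then have "q0 \<le> 2 ^ r" using less_exp[of r] by linarith
    then have "(2 ^ r) ^ Suc k \<le> extremal_number n (theta k l)"
      using bnd rn by (simp only: simp_thms)
    then have ext: "(2 ^ r) ^ Suc k \<le> real (extremal_number n (theta k l))"
      by (simp flip: of_nat_le_iff[where 'a = real])
    have "c * real n powr (1 + 1 / real k) = (real n / 2 ^ Suc k) powr (1 + 1 / real k)"
      unfolding c_def by (subst powr_mult[symmetric]) auto
    also have "real n < 2 ^ Suc k * (2 ^ r) ^ k"
      using nr by (simp flip: of_nat_less_iff[where 'a = real])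
    then have "(real n / 2 ^ Suc k) powr (1 + 1 / real k) \<le> ((2 ^ r) ^ k) powr (1 + 1 / real k)"
      by (intro powr_mono2) (auto simp: field_simps)
    also have "((2 ^ r) ^ k) powr (1 + 1 / real k) = (2 ^ r :: real) powr (real k * (1 + 1 / real k))"
      by (simp add: powr_powr mult.assoc flip: powr_realpow)
    also have "real k * (1 + 1 / real k) = real (Suc k)"
      using assms by (simp add: field_simps)
    also have "(2 ^ r :: real) powr real (Suc k) = (2 ^ r) ^ Suc k"
      by (rule powr_realpow) simp
    finally show ?thesis using ext by linarith
  qed
  have "c > 0" by (simp add: c_def)
  moreover have "\<forall>\<^sub>F n in sequentially.
      real (extremal_number n (theta k l)) \<ge> c * real n powr (1 + 1 / real k)"
    using eventually_ge_at_top[of "2 * (2 ^ q0) ^ k"] by eventually_elim (rule bound)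
  ultimately show ?thesis using l by blast
qed

end
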